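(* If $L^\star$ has the Fredholm property and is $*$-closed, then $T^\star$ has the Fredholm property. That is, for every admissible $\mathbf{g}=(g_0,g_1)$ and all projections $P_0\in L^0(\mathbf{g}_0)$, $P_1\in L^0(\mathbf{g}_1)$: (a) every $R\in T^{-\infty}(\mathbf{g},P_0,P_1)$ is a compact operator $H^0(g_0,P_0)\to H^0(g_1,P_1)$; (b) if $A\in T^0(\mathbf{g},P_0,P_1)$ is a Fredholm operator $H^0(g_0,P_0)\to H^0(g_1,P_1)$, then $A$ is elliptic in $T^\star$.
   Context: Setting. With every "datum" $g$ there is associated a scale of Hilbert spaces $H^s(g)$, $s\in\mathbb{N}_0=\{0,1,2,\dots\}$, with continuous inclusions $H^{s+1}(g)\subset H^s(g)$. $\mathbf{G}$ is a set of "admissible" pairs $\mathbf{g}=(g_0,g_1)$ of data; for such a pair write $\mathbf{g}^{(-1)}=(g_1,g_0)$, $\mathbf{g}_0=(g_0,g_0)$, $\mathbf{g}_1=(g_1,g_1)$; these are also admissible, and if $(g_0,g_1),(g_1,g_2)$ are admissible, so is $(g_0,g_2)$. For each admissible $\mathbf{g}$ and each integer $\mu\le 0$, $L^\mu(\mathbf{g})$ is a vector space of linear operators $A:H^0(g_0)\to H^0(g_1)$ inducing continuous operators $A:H^s(g_0)\to H^{s-\mu}(g_1)$ for all $s\in\mathbb{N}_0$. It is assumed that $L^\mu(\mathbf{g})\subset L^\nu(\mathbf{g})$ for $\mu\le\nu$, that composition maps $L^\mu((g_1,g_2))\times L^\nu((g_0,g_1))$ into $L^{\mu+\nu}((g_0,g_2))$,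 and that the identity $1$ belongs to $L^0((g,g))$ for admissible $(g,g)$. $L^\star$ is the union of all $L^\mu(\mathbf{g})$, and $L^{-\infty}(\mathbf{g})=\bigcap_{\mu\le0}L^\mu(\mathbf{g})$ (smoothing operators). Ellipticity in $L^\star$: $A\in L^0(\mathbf{g})$ is elliptic if there is $B\in L^0(\mathbf{g}^{(-1)})$ with $BA-1\in L^{-\infty}(\mathbf{g}_0)$ and $AB-1\in L^{-\infty}(\mathbf{g}_1)$. $L^\star$ has the Fredholm property if for every admissible $\mathbf{g}$: (a) every $R\in L^{-\infty}(\mathbf{g})$ is compact $H^0(g_0)\to H^0(g_1)$; (b) if $A\in L^0(\mathbf{g})$ is a Fredholm operator $H^0(g_0)\to H^0(g_1)$, then $A$ is elliptic. $L^\star$ is $*$-closed if for every admissible $\mathbf{g}$ and $A\in L^0(\mathbf{g})$ there is $A^*\in L^0(\mathbf{g}^{(-1)})$ such that $A^*:H^0(g_1)\to H^0(g_0)$ is the Hilbert space adjoint of $A:H^0(g_0)\to H^0(g_1)$. Toeplitz subalgebras: for projections $P_j\in L^0(\mathbf{g}_j)$, $P_j^2=P_j$ ($j=0,1$), put $T^\mu(\mathbf{g},P_0,P_1)=\{A\in L^\mu(\mathbf{g}) : (1-P_1)A=0,\ A(1-P_0)=0\}$ and $T^{-\infty}(\mathbf{g},P_0,P_1)=\bigcap_{\mu\le0}T^\mu(\mathbf{g},P_0,P_1)$. $T^\star$ is the union of all $T^\mu(\mathbf{g},P_0,P_1)$. Put $H^s(g_j,P_j)=P_j(H^s(g_j))$,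 a closed subspace of $H^s(g_j)$; every $A\in T^\mu(\mathbf{g},P_0,P_1)$ induces continuous operators $H^s(g_0,P_0)\to H^{s-\mu}(g_1,P_1)$. Ellipticity in $T^\star$: $A\in T^0(\mathbf{g},P_0,P_1)$ is elliptic if there is $B\in T^0(\mathbf{g}^{(-1)},P_1,P_0)$ with $BA-P_0\in T^{-\infty}(\mathbf{g}_0,P_0,P_0)$ and $AB-P_1\in T^{-\infty}(\mathbf{g}_1,P_1,P_1)$. *)

theory Defs
  imports "HOL-Analysis.Analysis"
begin

section \<open>Complex Hilbert spaces inside an ambient vector space\<close>

text \<open>
  The spaces attached to different data are different spaces with different inner products, so they
  cannot be types of an inner product class. They are linear subspaces of one ambient complex
  vector space, each with its own inner product. The ambient space carries no topology and the
  inner products are not related to each other, so any family of Hilbert spaces can be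
  realised in this way (embed its members into their direct sum).
\<close>

record 'v hspace =
  hcarrier :: "'v set"
  hinner :: "'v \<Rightarrow> 'v \<Rightarrow> complex"

definition hnorm :: "('v, 'm) hspace_scheme \<Rightarrow> 'v \<Rightarrow> real" where
  "hnorm X x = sqrt (Re (hinner X x x))"

text \<open>The value 0 off the carrier is forced by the locale \<^locale>\<open>Metric_space\<close>, which requires
  nonnegativity and symmetry on the whole type.\<close>

definition hdist :: "('v::ab_group_add, 'm) hspace_scheme \<Rightarrow> 'v \<Rightarrow> 'v \<Rightarrow> real" where
  "hdist X x y = (if x \<in> hcarrier X \<and> y \<in> hcarrier X then hnorm X (x - y) else 0)"

abbreviation htop :: "('v::ab_group_add, 'm) hspace_scheme \<Rightarrow> 'v topology" where
  "htop X \<equiv> Metric_space.mtopology (hcarrier X) (hdist X)"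

locale complex_vector_space = vector_space scale
  for scale :: "complex \<Rightarrow> 'v::ab_group_add \<Rightarrow> 'v" (infixr \<open>*\<^sub>C\<close> 75)
begin

definition hilbert_space :: "'v hspace \<Rightarrow> bool" where
  "hilbert_space X \<longleftrightarrow>
     subspace (hcarrier X) \<and>
     (\<forall>x\<in>hcarrier X. \<forall>y\<in>hcarrier X. \<forall>z\<in>hcarrier X.
        hinner X (x + y) z = hinner X x z + hinner X y z) \<and>
     (\<forall>c. \<forall>x\<in>hcarrier X. \<forall>y\<in>hcarrier X. hinner X (c *\<^sub>C x) y = c * hinner X x y) \<and>
     (\<forall>x\<in>hcarrier X. \<forall>y\<in>hcarrier X. hinner X x y = cnj (hinner X y x)) \<and>
     (\<forall>x\<in>hcarrier X. x \<noteq> 0 \<longrightarrow> Re (hinner X x x) > 0) \<and>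
     Metric_space.mcomplete (hcarrier X) (hdist X)"

definition linear_op :: "'v hspace \<Rightarrow> 'v hspace \<Rightarrow> ('v \<Rightarrow> 'v) \<Rightarrow> bool" where
  "linear_op X Y f \<longleftrightarrow>
     f \<in> hcarrier X \<rightarrow> hcarrier Y \<and>
     (\<forall>x\<in>hcarrier X. \<forall>y\<in>hcarrier X. f (x + y) = f x + f y) \<and>
     (\<forall>c. \<forall>x\<in>hcarrier X. f (c *\<^sub>C x) = c *\<^sub>C f x)"

definition continuous_linear_op :: "'v hspace \<Rightarrow> 'v hspace \<Rightarrow> ('v \<Rightarrow> 'v) \<Rightarrow> bool" where
  "continuous_linear_op X Y f \<longleftrightarrow> linear_op X Y f \<and> continuous_map (htop X) (htop Y) f"

definition compact_op :: "'v hspace \<Rightarrow> 'v hspace \<Rightarrow> ('v \<Rightarrow> 'v) \<Rightarrow> bool" where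
  "compact_op X Y f \<longleftrightarrow>
     linear_op X Y f \<and>
     compactin (htop Y) (htop Y closure_of (f ` {x \<in> hcarrier X. hnorm X x \<le> 1}))"

text \<open>The third clause says that the cokernel is finite-dimensional: the quotient of \<open>Y\<close> by the
  range is spanned by the classes of finitely many vectors. Closedness of the range is not
  part of the definition; it follows from the other conditions by the open mapping theorem.\<close>

definition fredholm_op :: "'v hspace \<Rightarrow> 'v hspace \<Rightarrow> ('v \<Rightarrow> 'v) \<Rightarrow> bool" where
  "fredholm_op X Y f \<longleftrightarrow>
     continuous_linear_op X Y f \<and>
     (\<exists>B. finite B \<and> {x \<in> hcarrier X. f x = 0} = span B) \<and>
     (\<exists>B. finite B \<and> B \<subseteq> hcarrier Y \<and> hcarrier Y = span (f ` hcarrier X \<union> B))"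

definition is_adjoint :: "'v hspace \<Rightarrow> 'v hspace \<Rightarrow> ('v \<Rightarrow> 'v) \<Rightarrow> ('v \<Rightarrow> 'v) \<Rightarrow> bool" where
  "is_adjoint X Y f f' \<longleftrightarrow>
     continuous_linear_op Y X f' \<and>
     (\<forall>x\<in>hcarrier X. \<forall>y\<in>hcarrier Y. hinner Y (f x) y = hinner X x (f' y))"

lemma hilbert_space_Metric_space:
  assumes "hilbert_space X"
  shows "Metric_space (hcarrier X) (hdist X)"
proof -
  let ?C = "hcarrier X" and ?i = "hinner X"
  have S: "subspace ?C"
    and add: "\<And>x y z. x \<in> ?C \<Longrightarrow> y \<in> ?C \<Longrightarrow> z \<in> ?C \<Longrightarrow> ?i (x + y) z = ?i x z + ?i y z"
    and scl: "\<And>c x y. x \<in> ?C \<Longrightarrow> y \<in> ?C \<Longrightarrow> ?i (c *\<^sub>C x) y = c * ?i x y"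
    and sym: "\<And>x y. x \<in> ?C \<Longrightarrow> y \<in> ?C \<Longrightarrow> ?i x y = cnj (?i y x)"
    and pos: "\<And>x. x \<in> ?C \<Longrightarrow> x \<noteq> 0 \<Longrightarrow> Re (?i x x) > 0"
    using assms unfolding hilbert_space_def by blast+
  have mem: "x + y \<in> ?C" "c *\<^sub>C x \<in> ?C" "x - y \<in> ?C" "0 \<in> ?C" if "x \<in> ?C" "y \<in> ?C" for x y c
    using that S by (auto simp: subspace_add subspace_scale subspace_diff subspace_0)
  have zero: "?i 0 0 = 0" if "x \<in> ?C" for x
    using scl[of 0 0 0] mem(4)[OF that that] by simp
  have nn: "Re (?i x x) \<ge> 0" if "x \<in> ?C" for x
    using pos[OF that] zero[OF that] by (cases "x = 0") auto
  have rsym: "Re (?i x y) = Re (?i y x)" if "x \<in> ?C" "y \<in> ?C" for x y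
    using sym[OF that] by simp
  have radd: "Re (?i z (x + y)) = Re (?i z x) + Re (?i z y)" if "x \<in> ?C" "y \<in> ?C" "z \<in> ?C" for x y z
    using that by (simp add: rsym[of z] mem add)
  have rscl: "Re (?i y (of_real t *\<^sub>C x)) = t * Re (?i y x)" if "x \<in> ?C" "y \<in> ?C" for x y t
    using that by (simp add: rsym[of y] mem scl)
  have expand: "Re (?i (x + of_real t *\<^sub>C y) (x + of_real t *\<^sub>C y))
      = Re (?i x x) + 2 * t * Re (?i x y) + t\<^sup>2 * Re (?i y y)" if "x \<in> ?C" "y \<in> ?C" for x y t
    using that by (simp add: add radd mem scl rscl rsym[of y x] power2_eq_square algebra_simps)
  have CS: "Re (?i x y) \<le> hnorm X x * hnorm X y" if xy: "x \<in> ?C" "y \<in> ?C" for x y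
  proof (cases "y = 0")
    case True
    have "Re (?i x 0) = 0" using rscl[of x x 0] xy by simp
    then show ?thesis using True zero[OF xy(1)] by (simp add: hnorm_def)
  next
    case False
    define a b c where "a = Re (?i x x)" and "b = Re (?i x y)" and "c = Re (?i y y)"
    have c: "c > 0" using pos[OF xy(2) False] by (simp add: c_def)
    have "0 \<le> a + 2 * (- b / c) * b + (- b / c)\<^sup>2 * c"
      unfolding a_def b_def c_def expand[OF xy, symmetric] using nn xy mem by blast
    also have "\<dots> = a - b\<^sup>2 / c" using c by (simp add: field_simps power2_eq_square)
    finally have "b\<^sup>2 \<le> a * c" using c by (simp add: field_simps)
    then have "\<bar>b\<bar> \<le> sqrt (a * c)" by (metis real_sqrt_abs real_sqrt_le_mono)
    then show ?thesis by (simp add: hnorm_def a_def b_def c_def real_sqrt_mult)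
  qed
  have tri: "hnorm X (x + y) \<le> hnorm X x + hnorm X y" if "x \<in> ?C" "y \<in> ?C" for x y
  proof -
    have "Re (?i (x + y) (x + y)) = Re (?i x x) + 2 * Re (?i x y) + Re (?i y y)"
      using expand[OF that, of 1] by simp
    also have "\<dots> \<le> (hnorm X x + hnorm X y)\<^sup>2"
      using CS[OF that] nn that by (simp add: hnorm_def power2_sum)
    finally show ?thesis
      using nn that unfolding hnorm_def[of X "x + y"] by (intro real_le_lsqrt) (auto simp: hnorm_def)
  qed
  have comm: "hnorm X (x - y) = hnorm X (y - x)" if "x \<in> ?C" "y \<in> ?C" for x y
  proof -
    have e: "x - y = of_real (-1) *\<^sub>C (y - x)" by (simp add: algebra_simps)
    have d: "y - x \<in> ?C" "of_real (-1) *\<^sub>C (y - x) \<in> ?C" using that mem by auto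
    have "Re (?i (of_real (-1) *\<^sub>C (y - x)) (of_real (-1) *\<^sub>C (y - x))) = Re (?i (y - x) (y - x))"
      unfolding rscl[OF d(1) d(2)] scl[OF d(1) d(1)] by simp
    then show ?thesis unfolding hnorm_def e by simp
  qed
  show ?thesis
  proof
    fix x y show "0 \<le> hdist X x y" using nn mem by (simp add: hdist_def hnorm_def)
  next
    fix x y show "hdist X x y = hdist X y x" using comm by (simp add: hdist_def)
  next
    fix x y assume xy: "x \<in> ?C" "y \<in> ?C"
    show "hdist X x y = 0 \<longleftrightarrow> x = y"
      using xy pos[of "x - y"] mem zero by (force simp: hdist_def hnorm_def)
  next
    fix x y z assume "x \<in> ?C" "y \<in> ?C" "z \<in> ?C"
    then show "hdist X x z \<le> hdist X x y + hdist X y z"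
      using tri[of "x - y" "y - z"] mem by (simp add: hdist_def)
  qed
qed

end


section \<open>Operator algebras\<close>

text \<open>
  \<open>H s g\<close> is the space $H^s(g)$; \<open>G\<close> is the set of admissible pairs; \<open>L \<mu> g\<^sub>0 g\<^sub>1\<close>, which is
  only meaningful for \<open>\<mu> \<le> 0\<close> and \<open>(g\<^sub>0, g\<^sub>1) \<in> G\<close>, is $L^\mu((g_0,g_1))$. An operator on
  $H^0(g_0)$ is an extensional function on the carrier of \<open>H 0 g\<^sub>0\<close>, so that equality of functions is
  equality of operators.
\<close>

locale operator_algebra = complex_vector_space scale
  for scale :: "complex \<Rightarrow> 'v::ab_group_add \<Rightarrow> 'v" (infixr \<open>*\<^sub>C\<close> 75) +
  fixes H :: "nat \<Rightarrow> 'd \<Rightarrow> 'v hspace"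
    and G :: "('d \<times> 'd) set"
    and L :: "int \<Rightarrow> 'd \<Rightarrow> 'd \<Rightarrow> ('v \<Rightarrow> 'v) set"
  assumes hilbert: "hilbert_space (H s g)"
    and scale_subset: "hcarrier (H (Suc s) g) \<subseteq> hcarrier (H s g)"
    and scale_continuous: "continuous_map (htop (H (Suc s) g)) (htop (H s g)) (\<lambda>x. x)"
    and admissible_inverse: "(g0, g1) \<in> G \<Longrightarrow> (g1, g0) \<in> G"
    and admissible_left: "(g0, g1) \<in> G \<Longrightarrow> (g0, g0) \<in> G"
    and admissible_right: "(g0, g1) \<in> G \<Longrightarrow> (g1, g1) \<in> G"
    and admissible_trans: "(g0, g1) \<in> G \<Longrightarrow> (g1, g2) \<in> G \<Longrightarrow> (g0, g2) \<in> G"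
    and L_extensional: "(g0, g1) \<in> G \<Longrightarrow> \<mu> \<le> 0 \<Longrightarrow> A \<in> L \<mu> g0 g1 \<Longrightarrow>
          A \<in> extensional (hcarrier (H 0 g0))"
    and L_linear: "(g0, g1) \<in> G \<Longrightarrow> \<mu> \<le> 0 \<Longrightarrow> A \<in> L \<mu> g0 g1 \<Longrightarrow>
          linear_op (H 0 g0) (H 0 g1) A"
    and L_continuous: "(g0, g1) \<in> G \<Longrightarrow> \<mu> \<le> 0 \<Longrightarrow> A \<in> L \<mu> g0 g1 \<Longrightarrow>
          continuous_linear_op (H s g0) (H (nat (int s - \<mu>)) g1) A"
    and L_zero: "(g0, g1) \<in> G \<Longrightarrow> \<mu> \<le> 0 \<Longrightarrow> (\<lambda>x\<in>hcarrier (H 0 g0). 0) \<in> L \<mu> g0 g1"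
    and L_add: "(g0, g1) \<in> G \<Longrightarrow> \<mu> \<le> 0 \<Longrightarrow> A \<in> L \<mu> g0 g1 \<Longrightarrow> B \<in> L \<mu> g0 g1 \<Longrightarrow>
          (\<lambda>x\<in>hcarrier (H 0 g0). A x + B x) \<in> L \<mu> g0 g1"
    and L_scale: "(g0, g1) \<in> G \<Longrightarrow> \<mu> \<le> 0 \<Longrightarrow> A \<in> L \<mu> g0 g1 \<Longrightarrow>
          (\<lambda>x\<in>hcarrier (H 0 g0). c *\<^sub>C A x) \<in> L \<mu> g0 g1"
    and L_mono: "(g0, g1) \<in> G \<Longrightarrow> \<mu> \<le> \<nu> \<Longrightarrow> \<nu> \<le> 0 \<Longrightarrow> L \<mu> g0 g1 \<subseteq> L \<nu> g0 g1"
    and L_compose: "(g0, g1) \<in> G \<Longrightarrow> (g1, g2) \<in> G \<Longrightarrow> \<mu> \<le> 0 \<Longrightarrow> \<nu> \<le> 0 \<Longrightarrow>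
          A \<in> L \<mu> g1 g2 \<Longrightarrow> B \<in> L \<nu> g0 g1 \<Longrightarrow>
          compose (hcarrier (H 0 g0)) A B \<in> L (\<mu> + \<nu>) g0 g2"
    and L_one: "(g, g) \<in> G \<Longrightarrow> (\<lambda>x\<in>hcarrier (H 0 g). x) \<in> L 0 g g"
begin

text \<open>\<open>H0 g\<close> is the underlying set of $H^0(g)$, \<open>op_one g\<close> the identity operator, and \<open>op_prod g A B\<close>
  and \<open>op_diff g A B\<close> are the operators $AB$ and $A-B$ with domain $H^0(g)$.\<close>

abbreviation H0 :: "'d \<Rightarrow> 'v set" where
  "H0 g \<equiv> hcarrier (H 0 g)"

abbreviation op_one :: "'d \<Rightarrow> 'v \<Rightarrow> 'v" where
  "op_one g \<equiv> (\<lambda>x\<in>H0 g. x)"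

abbreviation op_prod :: "'d \<Rightarrow> ('v \<Rightarrow> 'v) \<Rightarrow> ('v \<Rightarrow> 'v) \<Rightarrow> 'v \<Rightarrow> 'v" where
  "op_prod g A B \<equiv> compose (H0 g) A B"

abbreviation op_diff :: "'d \<Rightarrow> ('v \<Rightarrow> 'v) \<Rightarrow> ('v \<Rightarrow> 'v) \<Rightarrow> 'v \<Rightarrow> 'v" where
  "op_diff g A B \<equiv> (\<lambda>x\<in>H0 g. A x - B x)"

definition L_smoothing :: "'d \<Rightarrow> 'd \<Rightarrow> ('v \<Rightarrow> 'v) set" where
  "L_smoothing g0 g1 = (\<Inter>\<mu>\<in>{..0}. L \<mu> g0 g1)"

definition L_elliptic :: "'d \<Rightarrow> 'd \<Rightarrow> ('v \<Rightarrow> 'v) \<Rightarrow> bool" where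
  "L_elliptic g0 g1 A \<longleftrightarrow>
     A \<in> L 0 g0 g1 \<and>
     (\<exists>B\<in>L 0 g1 g0.
        op_diff g0 (op_prod g0 B A) (op_one g0) \<in> L_smoothing g0 g0 \<and>
        op_diff g1 (op_prod g1 A B) (op_one g1) \<in> L_smoothing g1 g1)"

definition L_fredholm_property :: bool where
  "L_fredholm_property \<longleftrightarrow>
     (\<forall>(g0, g1)\<in>G.
        (\<forall>R\<in>L_smoothing g0 g1. compact_op (H 0 g0) (H 0 g1) R) \<and>
        (\<forall>A\<in>L 0 g0 g1. fredholm_op (H 0 g0) (H 0 g1) A \<longrightarrow> L_elliptic g0 g1 A))"

definition L_star_closed :: bool where
  "L_star_closed \<longleftrightarrow>
     (\<forall>(g0, g1)\<in>G. \<forall>A\<in>L 0 g0 g1. \<exists>A'\<in>L 0 g1 g0. is_adjoint (H 0 g0) (H 0 g1) A A')"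


subsection \<open>Toeplitz subalgebras\<close>

definition is_projection :: "'d \<Rightarrow> ('v \<Rightarrow> 'v) \<Rightarrow> bool" where
  "is_projection g P \<longleftrightarrow> P \<in> L 0 g g \<and> op_prod g P P = P"

definition T :: "int \<Rightarrow> 'd \<Rightarrow> 'd \<Rightarrow> ('v \<Rightarrow> 'v) \<Rightarrow> ('v \<Rightarrow> 'v) \<Rightarrow> ('v \<Rightarrow> 'v) set" where
  "T \<mu> g0 g1 P0 P1 =
     {A \<in> L \<mu> g0 g1. op_prod g0 (op_diff g1 (op_one g1) P1) A = (\<lambda>x\<in>H0 g0. 0) \<and>
                     op_prod g0 A (op_diff g0 (op_one g0) P0) = (\<lambda>x\<in>H0 g0. 0)}"

definition T_smoothing :: "'d \<Rightarrow> 'd \<Rightarrow> ('v \<Rightarrow> 'v) \<Rightarrow> ('v \<Rightarrow> 'v) \<Rightarrow> ('v \<Rightarrow> 'v) set" where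
  "T_smoothing g0 g1 P0 P1 = (\<Inter>\<mu>\<in>{..0}. T \<mu> g0 g1 P0 P1)"

text \<open>The space $H^s(g,P) = P(H^s(g))$ with the inner product of $H^s(g)$.\<close>

definition HP :: "nat \<Rightarrow> 'd \<Rightarrow> ('v \<Rightarrow> 'v) \<Rightarrow> 'v hspace" where
  "HP s g P = \<lparr>hcarrier = P ` hcarrier (H s g), hinner = hinner (H s g)\<rparr>"

definition T_elliptic :: "'d \<Rightarrow> 'd \<Rightarrow> ('v \<Rightarrow> 'v) \<Rightarrow> ('v \<Rightarrow> 'v) \<Rightarrow> ('v \<Rightarrow> 'v) \<Rightarrow> bool" where
  "T_elliptic g0 g1 P0 P1 A \<longleftrightarrow>
     A \<in> T 0 g0 g1 P0 P1 \<and>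
     (\<exists>B\<in>T 0 g1 g0 P1 P0.
        op_diff g0 (op_prod g0 B A) P0 \<in> T_smoothing g0 g0 P0 P0 \<and>
        op_diff g1 (op_prod g1 A B) P1 \<in> T_smoothing g1 g1 P1 P1)"

text \<open>Compactness and the Fredholm property between \<open>HP 0 g\<^sub>0 P\<^sub>0\<close> and \<open>HP 0 g\<^sub>1 P\<^sub>1\<close> only involve
  the values of an operator on the carrier of \<open>HP 0 g\<^sub>0 P\<^sub>0\<close>, that is, its restriction.\<close>

definition T_fredholm_property :: bool where
  "T_fredholm_property \<longleftrightarrow>
     (\<forall>(g0, g1)\<in>G. \<forall>P0 P1. is_projection g0 P0 \<longrightarrow> is_projection g1 P1 \<longrightarrow>
        (\<forall>R\<in>T_smoothing g0 g1 P0 P1. compact_op (HP 0 g0 P0) (HP 0 g1 P1) R) \<and>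
        (\<forall>A\<in>T 0 g0 g1 P0 P1.
           fredholm_op (HP 0 g0 P0) (HP 0 g1 P1) A \<longrightarrow> T_elliptic g0 g1 P0 P1 A))"

end

end

theory Submission
  imports Defs
begin

text \<open>
  If \<open>A\<close> maps $H^0(g_0)$ onto a subspace of finite codimension in $P_1(H^0(g_1))$, then
  $D = AA^* + (1-P_1)(1-P_1)^*$ is Fredholm: adding a finite-rank term makes it coercive, because the
  set on which the quadratic form is at most 1 is weakly bounded, hence bounded. So $D$ has a
  parametrix $E$ in $L^\star$, and as $P_1 D = AA^*$, the operator $B = P_0A^*EP_1$ satisfies
  $AB - P_1 = P_1(DE-1)P_1$, which is smoothing. If moreover \<open>A\<close> has finite-dimensional kernel on
  $P_0(H^0(g_0))$, then $B$ also has a range of finite codimension, because $AB$ is a compact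
  perturbation of $P_1$. Applying the construction to $B$ shows that $B$ is a two-sided parametrix.
\<close>

section \<open>Operators on Hilbert spaces given by carriers\<close>

text \<open>The obstacle is that the complements of the ranges of \<open>P0\<close> and
  \<open>P1\<close> are unrelated: one may be infinite-dimensional and the other zero. So
  \<open>A\<close> cannot in general be completed to a Fredholm operator from \<open>H0 g0\<close>
  to \<open>H0 g1\<close> by an operator between the complements. Passing to $AA^*$ leaves only the
  space \<open>H0 g1\<close>, where $1-P_1$ itself fills the complement. The operator $D$ is $TT^*$
  for $T(x,w) = Ax + (1-P_1)w$, and the range of $T$ has finite codimension because every $z$ is
  $P_1z + (1-P_1)z$. The projections need not be orthogonal; $P_1D = AA^*$ rests only on $P_1(1-P_1)
  = 0$. The left side is not treated by a mirrored argument with $A^*A$, which would have to start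
  from closedness of the range of $A$. A right parametrix only asks for a range of finite
  codimension, so the same construction serves $B$; the rest is the algebraic fact that an element
  with a right inverse which itself has a right inverse is invertible, read modulo smoothing
  operators.\<close>

context complex_vector_space
begin

section \<open>Linear operators and finite-dimensional subspaces\<close>

lemma linear_opD:
  assumes "linear_op X Y f"
  shows "x \<in> hcarrier X \<Longrightarrow> f x \<in> hcarrier Y"
    and "x \<in> hcarrier X \<Longrightarrow> y \<in> hcarrier X \<Longrightarrow> f (x + y) = f x + f y"
    and "x \<in> hcarrier X \<Longrightarrow> f (c *\<^sub>C x) = c *\<^sub>C f x"
  using assms by (auto simp: linear_op_def)

lemma linear_op_0:
  assumes "linear_op X Y f" "0 \<in> hcarrier X"
  shows "f 0 = 0"
  using linear_opD(3)[OF assms, of 0] by simp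

lemma linear_op_diff:
  assumes f: "linear_op X Y f" and X: "subspace (hcarrier X)" and "x \<in> hcarrier X" "y \<in> hcarrier X"
  shows "f (x - y) = f x - f y"
  using linear_opD(2)[OF f, of "x - y" y] assms by (simp add: subspace_diff)

lemma finite_spanning_subset:
  assumes "finite F" "S \<subseteq> span F" "subspace S"
  obtains B where "finite B" "B \<subseteq> S" "span B = S"
proof -
  obtain B where B: "B \<subseteq> S" "independent B" "S \<subseteq> span B"
    by (rule maximal_independent_subset)
  have "finite B"
    using independent_span_bound[OF assms(1) B(2)] B(1) assms(2) by blast
  then show ?thesis
    using that B span_subspace[OF B(1) B(3) assms(3)] by blast
qed

lemma subspace_linear_op_image:
  assumes f: "linear_op X Y f" and S: "subspace S" "S \<subseteq> hcarrier X"
  shows "subspace (f ` S)"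
proof (rule subspaceI)
  show "0 \<in> f ` S"
    using linear_op_0[OF f] subspace_0[OF S(1)] S(2) by (metis image_iff subsetD)
  show "x + y \<in> f ` S" if "x \<in> f ` S" "y \<in> f ` S" for x y
  proof -
    from that obtain a b where ab: "a \<in> S" "b \<in> S" "x = f a" "y = f b" by blast
    moreover have "a \<in> hcarrier X" "b \<in> hcarrier X" using ab S(2) by auto
    ultimately have "x + y = f (a + b)" using linear_opD(2)[OF f] by simp
    then show ?thesis using ab subspace_add[OF S(1)] by auto
  qed
  show "c *\<^sub>C x \<in> f ` S" if "x \<in> f ` S" for c x
  proof -
    from that obtain a where a: "a \<in> S" "x = f a" by blast
    then have "c *\<^sub>C x = f (c *\<^sub>C a)" using linear_opD(3)[OF f, of a] S(2) by auto
    then show ?thesis using a subspace_scale[OF S(1)] by blast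
  qed
qed

lemma finite_spanning_linear_preimage:
  assumes f: "linear_op X Y f" and S: "subspace S" "S \<subseteq> hcarrier X"
    and inj: "\<And>x. x \<in> S \<Longrightarrow> f x = 0 \<Longrightarrow> x \<in> span N"
    and N: "finite N" and F: "finite F" "f ` S \<subseteq> span F"
  obtains B where "finite B" "B \<subseteq> S" "span B = S"
proof -
  obtain C where C: "finite C" "C \<subseteq> f ` S" "span C = f ` S"
    using finite_spanning_subset[OF F subspace_linear_op_image[OF f S]] .
  obtain D where D: "D \<subseteq> S" "finite D" "C = f ` D"
    using finite_subset_image[OF C(1,2)] by blast
  have "x \<in> span (D \<union> N)" if x: "x \<in> S" for x
  proof -
    have DS: "span D \<subseteq> S" using D(1) S(1) span_minimal by blast
    have "f x \<in> f ` span D"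
    proof -
      have "subspace (f ` span D)"
        using subspace_linear_op_image[OF f] DS S(2) by (meson order_trans subspace_span)
      moreover have "C \<subseteq> f ` span D" using D(3) span_superset by blast
      ultimately have "span C \<subseteq> f ` span D" by (simp add: span_minimal)
      then show ?thesis using x C(3) by blast
    qed
    then obtain d where d: "d \<in> span D" "f x = f d" by blast
    have "f (x - d) = f x - f d"
      using d DS x S(2) linear_opD(2)[OF f, of "x - d" d] subspace_diff[OF S(1)] by (metis diff_add_cancel eq_diff_eq subsetD)
    then have "x - d \<in> span N"
      using inj d DS x subspace_diff[OF S(1)] by auto
    then have "d + (x - d) \<in> span (D \<union> N)"
      using d(1) by (intro span_add) (meson span_mono subsetD sup_ge1 sup_ge2)+
    then show ?thesis by simp
  qed
  then show ?thesis
    using finite_spanning_subset[of "D \<union> N" S] D N S(1) that by blast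
qed

end

section \<open>Inner product geometry, completeness and compactness in one Hilbert space\<close>

locale hilbert_on = complex_vector_space scale
  for scale :: "complex \<Rightarrow> 'v::ab_group_add \<Rightarrow> 'v" (infixr \<open>*\<^sub>C\<close> 75) +
  fixes X :: "'v hspace"
  assumes hilbert_space_X: "hilbert_space X"
begin

abbreviation "C \<equiv> hcarrier X"
abbreviation "ip \<equiv> hinner X"
abbreviation "nm \<equiv> hnorm X"

lemma subspace_C: "subspace C"
  and ip_add_left: "x \<in> C \<Longrightarrow> y \<in> C \<Longrightarrow> z \<in> C \<Longrightarrow> ip (x + y) z = ip x z + ip y z"
  and ip_scale_left: "x \<in> C \<Longrightarrow> y \<in> C \<Longrightarrow> ip (c *\<^sub>C x) y = c * ip x y"
  and ip_cnj: "x \<in> C \<Longrightarrow> y \<in> C \<Longrightarrow> ip x y = cnj (ip y x)"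
  and ip_pos: "x \<in> C \<Longrightarrow> x \<noteq> 0 \<Longrightarrow> Re (ip x x) > 0"
  using hilbert_space_X unfolding hilbert_space_def by blast+

sublocale Metric_space C "hdist X"
  by (rule hilbert_space_Metric_space[OF hilbert_space_X])

lemma complete_C: mcomplete
  using hilbert_space_X unfolding hilbert_space_def by blast

lemma C_closed [simp]:
  "0 \<in> C" "x \<in> C \<Longrightarrow> y \<in> C \<Longrightarrow> x + y \<in> C" "x \<in> C \<Longrightarrow> y \<in> C \<Longrightarrow> x - y \<in> C" "x \<in> C \<Longrightarrow> c *\<^sub>C x \<in> C"
  "x \<in> C \<Longrightarrow> - x \<in> C"
  using subspace_C by (auto simp: subspace_0 subspace_add subspace_diff subspace_scale subspace_neg)

lemma C_sum [simp]: "(\<And>i. i \<in> I \<Longrightarrow> f i \<in> C) \<Longrightarrow> sum f I \<in> C"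
  using subspace_sum[OF subspace_C] by blast

lemma ip_add_right: "x \<in> C \<Longrightarrow> y \<in> C \<Longrightarrow> z \<in> C \<Longrightarrow> ip z (x + y) = ip z x + ip z y"
  by (simp add: ip_cnj[of z] ip_add_left)

lemma ip_scale_right: "x \<in> C \<Longrightarrow> y \<in> C \<Longrightarrow> ip y (c *\<^sub>C x) = cnj c * ip y x"
  by (simp add: ip_cnj[of y] ip_scale_left)

lemma ip_zero [simp]: "x \<in> C \<Longrightarrow> ip 0 x = 0" "x \<in> C \<Longrightarrow> ip x 0 = 0"
  using ip_scale_left[of 0 x 0] ip_scale_right[of 0 x 0] by simp_all

lemma ip_diff_left: "x \<in> C \<Longrightarrow> y \<in> C \<Longrightarrow> z \<in> C \<Longrightarrow> ip (x - y) z = ip x z - ip y z"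
  using ip_add_left[of "x - y" y z] by simp

lemma ip_diff_right: "x \<in> C \<Longrightarrow> y \<in> C \<Longrightarrow> z \<in> C \<Longrightarrow> ip z (x - y) = ip z x - ip z y"
  using ip_add_right[of "x - y" y z] by simp

lemmas ip_simps = ip_add_left ip_add_right ip_diff_left ip_diff_right ip_scale_left ip_scale_right

lemma ip_sum_left: "(\<And>i. i \<in> I \<Longrightarrow> f i \<in> C) \<Longrightarrow> z \<in> C \<Longrightarrow> ip (sum f I) z = (\<Sum>i\<in>I. ip (f i) z)"
  by (induction I rule: infinite_finite_induct) (simp_all add: ip_add_left)

lemma Re_ip_nonneg: "x \<in> C \<Longrightarrow> 0 \<le> Re (ip x x)"
  using ip_pos[of x] by (cases "x = 0") auto

lemma nm_nonneg [simp]: "x \<in> C \<Longrightarrow> 0 \<le> nm x"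
  by (simp add: hnorm_def Re_ip_nonneg)

lemma nm_squared: "x \<in> C \<Longrightarrow> (nm x)\<^sup>2 = Re (ip x x)"
  by (simp add: hnorm_def Re_ip_nonneg)

lemma ip_self: "x \<in> C \<Longrightarrow> ip x x = of_real ((nm x)\<^sup>2)"
  using ip_cnj[of x x] by (simp add: nm_squared complex_eq_iff)

lemma nm_eq_0 [simp]: "x \<in> C \<Longrightarrow> nm x = 0 \<longleftrightarrow> x = 0"
  using ip_pos[of x] ip_zero(1)[of 0] C_closed(1) by (force simp: hnorm_def)

lemma nm_scale: "x \<in> C \<Longrightarrow> nm (c *\<^sub>C x) = cmod c * nm x"
proof -
  assume x: "x \<in> C"
  have "ip (c *\<^sub>C x) (c *\<^sub>C x) = c * cnj c * ip x x"
    using x by (simp add: ip_scale_left ip_scale_right)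
  also have "\<dots> = of_real ((cmod c * nm x)\<^sup>2)"
    using x by (simp add: ip_self power_mult_distrib flip: complex_norm_square)
  finally have "ip (c *\<^sub>C x) (c *\<^sub>C x) = of_real ((cmod c * nm x)\<^sup>2)" .
  then show ?thesis using x by (simp add: hnorm_def[of X "c *\<^sub>C x"] del: of_real_power)
qed

lemma nm_zero [simp]: "nm 0 = 0"
  by simp

lemma nm_minus: "x \<in> C \<Longrightarrow> nm (- x) = nm x"
  using nm_scale[of x "-1"] by simp

lemma hdist_eq: "x \<in> C \<Longrightarrow> y \<in> C \<Longrightarrow> hdist X x y = nm (x - y)"
  by (simp add: hdist_def)

lemma nm_triangle: "x \<in> C \<Longrightarrow> y \<in> C \<Longrightarrow> nm (x + y) \<le> nm x + nm y"
  using triangle[of x 0 "- y"] by (simp add: hdist_eq nm_minus)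

lemma nm_sum: "(\<And>i. i \<in> I \<Longrightarrow> f i \<in> C) \<Longrightarrow> nm (sum f I) \<le> (\<Sum>i\<in>I. nm (f i))"
proof (induction I rule: infinite_finite_induct)
  case (insert i I)
  then show ?case using nm_triangle[of "f i" "sum f I"] by force
qed auto

lemma nm_diff_squared:
  "x \<in> C \<Longrightarrow> y \<in> C \<Longrightarrow> (nm (x - y))\<^sup>2 = (nm x)\<^sup>2 - 2 * Re (ip x y) + (nm y)\<^sup>2"
  by (simp add: nm_squared ip_simps ip_cnj[of y x])

lemma Cauchy_Schwarz:
  assumes x: "x \<in> C" and y: "y \<in> C"
  shows "cmod (ip x y) \<le> nm x * nm y"
proof (cases "y = 0")
  case False
  \<comment> \<open>\<open>c *\<^sub>C y\<close> is the orthogonal projection of \<open>x\<close>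
    onto the line through \<open>y\<close>.\<close>
  define c where "c = ip x y / of_real ((nm y)\<^sup>2)"
  have ny: "nm y > 0" using False y nm_nonneg[OF y] nm_eq_0[OF y] by linarith
  have "ip x (c *\<^sub>C y) = of_real ((cmod (ip x y))\<^sup>2 / (nm y)\<^sup>2)"
    using x y by (simp add: ip_simps c_def complex_norm_square mult.commute del: of_real_power)
  moreover have "(nm (c *\<^sub>C y))\<^sup>2 = (cmod (ip x y))\<^sup>2 / (nm y)\<^sup>2"
  proof -
    have "nm (c *\<^sub>C y) = cmod (ip x y) / nm y"
      using y ny by (simp add: nm_scale c_def norm_divide norm_power power2_eq_square norm_mult)
    then show ?thesis by (simp add: power_divide)
  qed
  ultimately have "(nm (x - c *\<^sub>C y))\<^sup>2 = (nm x)\<^sup>2 - (cmod (ip x y))\<^sup>2 / (nm y)\<^sup>2"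
    using nm_diff_squared[of x "c *\<^sub>C y"] x y by simp
  then have "(cmod (ip x y))\<^sup>2 / (nm y)\<^sup>2 \<le> (nm x)\<^sup>2"
    by (metis diff_ge_0_iff_ge zero_le_power2)
  then have "(cmod (ip x y))\<^sup>2 \<le> (nm x * nm y)\<^sup>2"
    using ny by (simp add: field_simps power_mult_distrib)
  then show ?thesis
    by (rule power2_le_imp_le) (use x y in auto)
qed (use x in simp)

text \<open>Uniform boundedness for the family \<open>ip x\<close> with \<open>x\<close> in
  \<open>E\<close>: the closed sets \<open>S n\<close> cover the complete space \<open>C\<close>, so
  by Baire one of them contains a ball, and testing \<open>x\<close> on a multiple of itself inside
  that ball recovers its norm.\<close>

lemma weakly_bounded_imp_bounded:
  assumes E: "E \<subseteq> C" and bdd: "\<And>z. z \<in> C \<Longrightarrow> \<exists>M. \<forall>x\<in>E. cmod (ip x z) \<le> M"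
  shows "\<exists>M. \<forall>x\<in>E. nm x \<le> M"
proof -
  define S where "S n = {z\<in>C. \<forall>x\<in>E. cmod (ip x z) \<le> real n}" for n
  have closed: "closedin mtopology (S n)" for n
    unfolding closedin_metric
  proof (intro conjI allI impI)
    fix z assume z: "z \<in> C - S n"
    then obtain x where x: "x \<in> E" "cmod (ip x z) > n" by (auto simp: S_def not_le)
    with E z have xC: "x \<in> C" "z \<in> C" by auto
    \<comment> \<open>The \<open>+ 1\<close> makes \<open>nm x * r\<close> strictly smaller than the
      gap \<open>cmod (ip x z) - n\<close>.\<close>
    define r where "r = (cmod (ip x z) - n) / (nm x + 1)"
    have nx: "nm x \<ge> 0" using xC by simp
    have "r > 0" unfolding r_def using x nx by (intro divide_pos_pos) auto
    moreover have "disjnt (S n) (mball z r)"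
      unfolding disjnt_iff
    proof (intro allI notI, elim conjE)
      fix w assume w: "w \<in> S n" "w \<in> mball z r"
      then have wC: "w \<in> C" "nm (z - w) < r" by (auto simp: hdist_eq)
      have "cmod (ip x z) \<le> cmod (ip x w) + cmod (ip x (z - w))"
        using norm_triangle_ineq[of "ip x w" "ip x (z - w)"] xC wC by (simp add: ip_diff_right)
      also have "\<dots> \<le> n + nm x * nm (z - w)"
        using w(1) x(1) Cauchy_Schwarz[of x "z - w"] xC wC by (intro add_mono) (auto simp: S_def)
      also have "nm x * nm (z - w) \<le> nm x * r"
        using wC nx by (intro mult_left_mono) auto
      also have "nm x * r < cmod (ip x z) - n"
        using x(2) nx by (simp add: r_def field_simps)
      finally show False by simp
    qed
    ultimately show "\<exists>r>0. disjnt (S n) (mball z r)" by blast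
  qed (auto simp: S_def)
  have "\<Union> (range S) = C"
  proof
    show "C \<subseteq> \<Union> (range S)"
    proof
      fix z assume z: "z \<in> C"
      then obtain M where M: "\<forall>x\<in>E. cmod (ip x z) \<le> M" using bdd by blast
      obtain n where "M \<le> real n" using real_arch_simple by blast
      then have "z \<in> S n" using z M by (force simp: S_def)
      then show "z \<in> \<Union> (range S)" by blast
    qed
  qed (auto simp: S_def)
  then have ne: "mtopology interior_of \<Union> (range S) \<noteq> {}"
    using C_closed(1) by (metis empty_iff interior_of_topspace topspace_mtopology)
  have "\<exists>n. mtopology interior_of S n \<noteq> {}"
  proof (rule ccontr)
    assume "\<nexists>n. mtopology interior_of S n \<noteq> {}"
    then have "mtopology interior_of \<Union> (range S) = {}"
      by (intro metric_Baire_category_alt[OF complete_C]) (auto simp: closed)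
    with ne show False by simp
  qed
  then obtain n z where "z \<in> mtopology interior_of S n" by blast
  then obtain r where r: "r > 0" "mball z r \<subseteq> S n" and z: "z \<in> C"
    unfolding metric_interior_of by auto
  \<comment> \<open>The vector \<open>u\<close> below points along \<open>x\<close> and has norm
    \<open>r / 2\<close>, so \<open>z + u\<close> stays in the open ball. Both
    \<open>ip x (z + u)\<close> and \<open>ip x z\<close> are bounded by \<open>n\<close>, so their
    difference \<open>r / 2 * nm x\<close> is at most \<open>2 * n\<close>.\<close>
  have "nm x \<le> 4 * n / r" if x: "x \<in> E" for x
  proof (cases "x = 0")
    case True
    then show ?thesis using r by simp
  next
    case False
    have xC: "x \<in> C" using x E by blast
    then have nx: "nm x > 0" using False nm_nonneg[of x] nm_eq_0[of x] by linarith
    define u where "u = of_real (r / (2 * nm x)) *\<^sub>C x"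
    have u: "u \<in> C" "nm u = r / 2"
      using xC nx r False by (simp_all add: u_def nm_scale del: of_real_divide)
    have "z + u \<in> mball z r" "z \<in> mball z r"
      using r u z by (auto simp: hdist_eq nm_minus)
    then have "z + u \<in> S n" "z \<in> S n" using r by auto
    then have "cmod (ip x (z + u)) \<le> n" "cmod (ip x z) \<le> n" using x by (auto simp: S_def)
    moreover have "ip x u = ip x (z + u) - ip x z" using xC u z by (simp add: ip_add_right)
    ultimately have "cmod (ip x u) \<le> 2 * n"
      using norm_triangle_ineq4[of "ip x (z + u)" "ip x z"] by simp
    moreover have "ip x u = of_real (r / 2 * nm x)"
      using xC nx by (simp add: u_def ip_scale_right ip_self power2_eq_square)
    ultimately have "\<bar>r / 2 * nm x\<bar> \<le> 2 * n" by (metis norm_of_real)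
    then show ?thesis using r nx by (simp add: field_simps)
  qed
  then show ?thesis by blast
qed

lemma contraction_fixpoint:
  assumes f: "f \<in> C \<rightarrow> C" and k: "k < 1"
    and con: "\<And>x y. x \<in> C \<Longrightarrow> y \<in> C \<Longrightarrow> nm (f x - f y) \<le> k * nm (x - y)"
  obtains x where "x \<in> C" "f x = x"
proof (rule Banach_fixedpoint_thm[OF complete_C _ f k])
  show "hdist X (f x) (f y) \<le> k * hdist X x y" if "x \<in> C" "y \<in> C" for x y
    using con[OF that] that f by (auto simp: hdist_eq Pi_iff)
  show "C \<noteq> {}" using C_closed(1) by blast
qed (use that in auto)

text \<open>Lax-Milgram by damped iteration: the fixed points of \<open>y - t (D y - z)\<close> are
  the solutions of \<open>D y = z\<close>, and for small \<open>t\<close> the linear gain from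
  coercivity outweighs the quadratic term \<open>t\<^sup>2 * (nm (D y))\<^sup>2\<close>, so the map
  is a contraction.\<close>

lemma coercive_surjective:
  assumes D: "linear_op X X D" and M: "\<And>y. y \<in> C \<Longrightarrow> nm (D y) \<le> M * nm y"
    and c: "c > 0" "\<And>y. y \<in> C \<Longrightarrow> c * (nm y)\<^sup>2 \<le> Re (ip (D y) y)"
    and z: "z \<in> C"
  obtains y where "y \<in> C" "D y = z"
proof -
  \<comment> \<open>A bound for \<open>D\<close> that is positive, so that it can be divided by, and
    at least \<open>c\<close>, so that \<open>q\<close> below is nonnegative.\<close>
  define N where "N = max 1 (max c M)"
  have N: "N > 0" "c \<le> N" "M \<le> N" by (auto simp: N_def)
  \<comment> \<open>The minimiser of \<open>1 - 2 * t * c + t\<^sup>2 * N\<^sup>2\<close>; the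
    minimum is the \<open>q\<close> defined next.\<close>
  define t where "t = c / N\<^sup>2"
  have t: "t > 0" using N c by (simp add: t_def)
  define q where "q = 1 - c\<^sup>2 / N\<^sup>2"
  have q: "0 \<le> q" "q < 1"
    using N c power_mono[of c N 2] by (auto simp: q_def field_simps)
  have DC: "D y \<in> C" if "y \<in> C" for y using linear_opD(1)[OF D that] .
  define f where "f y = y - of_real t *\<^sub>C (D y - z)" for y
  have est: "nm (y - of_real t *\<^sub>C D y) \<le> sqrt q * nm y" if y: "y \<in> C" for y
  proof -
    have "nm (D y) \<le> N * nm y"
      using M[OF y] N(3) mult_right_mono[OF N(3) nm_nonneg[OF y]] by linarith
    then have "(nm (D y))\<^sup>2 \<le> (N * nm y)\<^sup>2" by (intro power_mono) (simp_all add: DC y)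
    then have *: "(nm (D y))\<^sup>2 \<le> N\<^sup>2 * (nm y)\<^sup>2" by (simp add: power_mult_distrib)
    have "(nm (y - of_real t *\<^sub>C D y))\<^sup>2
        = (nm y)\<^sup>2 - 2 * (t * Re (ip (D y) y)) + t\<^sup>2 * (nm (D y))\<^sup>2"
      using y t by (simp add: nm_diff_squared DC nm_scale ip_scale_right ip_cnj[of y "D y"] power_mult_distrib)
    also have "\<dots> \<le> (nm y)\<^sup>2 - 2 * (t * (c * (nm y)\<^sup>2)) + t\<^sup>2 * (N\<^sup>2 * (nm y)\<^sup>2)"
      using c(2)[OF y] t * by (intro add_mono diff_mono mult_left_mono) auto
    also have "\<dots> = q * (nm y)\<^sup>2"
      using N by (simp add: t_def q_def field_simps power2_eq_square)
    also have "\<dots> = (sqrt q * nm y)\<^sup>2" using q by (simp add: power_mult_distrib)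
    finally show ?thesis by (rule power2_le_imp_le) (use q y in auto)
  qed
  have "nm (f x - f y) \<le> sqrt q * nm (x - y)" if xy: "x \<in> C" "y \<in> C" for x y
  proof -
    have "f x - f y = (x - y) - of_real t *\<^sub>C D (x - y)"
      using xy by (simp add: f_def linear_op_diff[OF D subspace_C] algebra_simps)
    then show ?thesis using est[of "x - y"] xy by simp
  qed
  moreover have "f \<in> C \<rightarrow> C" using DC z by (simp add: f_def)
  moreover have "sqrt q < 1" using q by simp
  ultimately obtain y where y: "y \<in> C" "f y = y" using contraction_fixpoint by metis
  then have "of_real t *\<^sub>C (D y - z) = 0" by (simp add: f_def)
  then have "D y = z" using t by simp
  then show ?thesis using y that by blast
qed

text \<open>Gram-Schmidt by induction on \<open>F\<close>: a new vector \<open>r\<close> contributes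
  the projection onto its component \<open>e\<close> orthogonal to \<open>span F\<close>.
  \<open>F\<close> may be linearly dependent.\<close>

lemma finite_dim_projection:
  assumes "finite F" "F \<subseteq> C"
  obtains p where "linear_op X X p" "\<And>y. y \<in> C \<Longrightarrow> p y \<in> span F"
    "\<And>y v. y \<in> C \<Longrightarrow> v \<in> span F \<Longrightarrow> ip (y - p y) v = 0"
proof -
  have "\<exists>p. linear_op X X p \<and> (\<forall>y\<in>C. p y \<in> span F) \<and> (\<forall>y\<in>C. \<forall>v\<in>span F. ip (y - p y) v = 0)"
    using assms
  proof (induction F)
    case empty
    have "linear_op X X (\<lambda>x. 0)" by (simp add: linear_op_def)
    then show ?case by (intro exI[of _ "\<lambda>x. 0"]) simp
  next
    case (insert r F)
    then obtain p where p: "linear_op X X p" "\<And>y. y \<in> C \<Longrightarrow> p y \<in> span F"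
      "\<And>y v. y \<in> C \<Longrightarrow> v \<in> span F \<Longrightarrow> ip (y - p y) v = 0" by auto
    have r: "r \<in> C" "F \<subseteq> C" using insert by auto
    have FC: "span F \<subseteq> C" using r subspace_C span_minimal by blast
    have pC: "p y \<in> C" if "y \<in> C" for y using p(2) FC that by blast
    define e where "e = r - p r"
    have e: "e \<in> C" "e \<in> span (insert r F)"
    proof -
      show "e \<in> C" using r pC by (simp add: e_def)
      show "e \<in> span (insert r F)" unfolding e_def
        using p(2)[OF r(1)] span_mono[of F "insert r F"] by (intro span_diff) (auto intro: span_base)
    qed
    have eF: "ip e v = 0" if "v \<in> span F" for v
      using p(3)[OF r(1) that] by (simp add: e_def)
    \<comment> \<open>If \<open>e = 0\<close>, then the coefficient is \<open>0 / 0 = 0\<close> and \<open>p' = p\<close>.\<close>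
    define p' where "p' y = p y + (ip y e / ip e e) *\<^sub>C e" for y
    have lin: "linear_op X X p'"
      unfolding linear_op_def p'_def using e pC linear_opD[OF p(1)]
      by (auto simp: ip_simps scale_right_distrib scale_left_distrib add_divide_distrib)
    have range: "p' y \<in> span (insert r F)" if "y \<in> C" for y
      unfolding p'_def using p(2)[OF that] e(2) span_mono[of F "insert r F"]
      by (intro span_add span_scale) auto
    have p'C: "p' y \<in> C" if "y \<in> C" for y using linear_opD(1)[OF lin that] .
    have orthF: "ip (y - p' y) v = 0" if y: "y \<in> C" and v: "v \<in> span F" for y v
    proof -
      have "v \<in> C" using v FC by blast
      then have "ip (y - p' y) v = ip (y - p y) v - (ip y e / ip e e) * ip e v"
        using y e pC by (simp add: p'_def ip_simps)
      then show ?thesis using p(3)[OF y v] eF[OF v] by simp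
    qed
    have orthe: "ip (y - p' y) e = 0" if y: "y \<in> C" for y
    proof -
      have "ip (p y) e = 0"
        using eF[OF p(2)[OF y]] ip_cnj[of "p y" e] pC[OF y] e by simp
      moreover have "e \<noteq> 0 \<Longrightarrow> ip e e \<noteq> 0" using ip_pos[of e] e by force
      ultimately show ?thesis
        using y e pC by (cases "e = 0") (simp_all add: p'_def ip_simps)
    qed
    have "ip (y - p' y) v = 0" if y: "y \<in> C" and v: "v \<in> span (insert r F)" for y v
    proof -
      obtain k where k: "v - k *\<^sub>C r \<in> span F" using v span_breakdown_eq by blast
      have "v - k *\<^sub>C e = (v - k *\<^sub>C r) + k *\<^sub>C p r"
        by (simp add: e_def scale_right_diff_distrib)
      also have "\<dots> \<in> span F"
        using span_add[OF k span_scale[OF p(2)[OF r(1)]]] .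
      finally have w: "v - k *\<^sub>C e \<in> span F" .
      then have wC: "v - k *\<^sub>C e \<in> C" using FC by blast
      have "ip (y - p' y) ((v - k *\<^sub>C e) + k *\<^sub>C e)
          = ip (y - p' y) (v - k *\<^sub>C e) + cnj k * ip (y - p' y) e"
        using wC e y p'C by (simp only: ip_add_right ip_scale_right C_closed)
      then show ?thesis using orthF[OF y w] orthe[OF y] by simp
    qed
    then show ?case using lin range by blast
  qed
  then show ?thesis using that by blast
qed

text \<open>Riesz theory for \<open>1 + R\<close>. A finite net \<open>F\<close> of mesh 1/2 for the
  image of the unit ball gives an operator \<open>p\<close> of finite rank such that
  \<open>g = R - p R\<close> has norm at most 1/2. Then \<open>1 + g\<close> is onto, and it differs
  from \<open>1 + R\<close> by \<open>- p R\<close>, whose values lie in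
  \<open>span F\<close>.\<close>

lemma compact_perturbation_finite_codim:
  assumes R: "compact_op X X R"
  obtains F where "finite F" "F \<subseteq> C"
    "\<And>z. z \<in> C \<Longrightarrow> \<exists>w\<in>C. \<exists>v\<in>span F. z = w + R w + v"
proof -
  have lin: "linear_op X X R" using R by (simp add: compact_op_def)
  have RC: "R y \<in> C" if "y \<in> C" for y using linear_opD(1)[OF lin that] .
  let ?U = "R ` {x \<in> C. nm x \<le> 1}"
  have "mtotally_bounded ?U"
    using R RC by (subst mtotally_bounded_eq_compact_closure_of[OF complete_C]) (auto simp: compact_op_def)
  then obtain F where F: "finite F" "F \<subseteq> ?U" "?U \<subseteq> (\<Union>x\<in>F. mball x (1/2))"
    unfolding mtotally_bounded_def by (meson half_gt_zero zero_less_one)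
  have FC: "F \<subseteq> C" using F(2) RC by auto
  obtain p where p: "linear_op X X p" "\<And>y. y \<in> C \<Longrightarrow> p y \<in> span F"
    "\<And>y v. y \<in> C \<Longrightarrow> v \<in> span F \<Longrightarrow> ip (y - p y) v = 0"
    using finite_dim_projection[OF F(1) FC] by metis
  have FC': "span F \<subseteq> C" using FC subspace_C span_minimal by blast
  have pC: "p y \<in> C" if "y \<in> C" for y using linear_opD(1)[OF p(1) that] .
  \<comment> \<open>By Pythagoras \<open>p y\<close> is the point of \<open>span F\<close> nearest
    to \<open>y\<close>, in particular no farther than any point of the net.\<close>
  have near: "nm (y - p y) \<le> nm (y - v)" if y: "y \<in> C" and v: "v \<in> span F" for y v
  proof -
    have vC: "v \<in> C" using v FC' by blast
    have *: "v - p y \<in> span F" using p(2)[OF y] v span_diff by blast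
    have "y - v = (y - p y) - (v - p y)" by simp
    then have "(nm (y - v))\<^sup>2 = (nm (y - p y))\<^sup>2 - 2 * Re (ip (y - p y) (v - p y)) + (nm (v - p y))\<^sup>2"
      using nm_diff_squared[of "y - p y" "v - p y"] vC pC[OF y] y by simp
    then have "(nm (y - p y))\<^sup>2 \<le> (nm (y - v))\<^sup>2" using p(3)[OF y *] by simp
    then show ?thesis by (rule power2_le_imp_le) (use y vC in auto)
  qed
  define g where "g u = R u - p (R u)" for u
  have gC: "g u \<in> C" if "u \<in> C" for u using that by (simp add: g_def RC pC)
  have glin: "linear_op X X g"
    using linear_opD[OF lin] linear_opD[OF p(1)]
    by (auto simp: linear_op_def g_def scale_right_diff_distrib)
  have half: "nm (g u) \<le> 1/2 * nm u" if u: "u \<in> C" for u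
  proof (cases "u = 0")
    case True
    then show ?thesis using linear_op_0[OF glin] by simp
  next
    case False
    then have nu: "nm u > 0" using u nm_nonneg[of u] nm_eq_0[of u] by linarith
    define u' where "u' = of_real (1 / nm u) *\<^sub>C u"
    have u': "u' \<in> C" "nm u' = 1" using u nu False by (simp_all add: u'_def nm_scale del: of_real_divide)
    then have "R u' \<in> ?U" by auto
    then have "R u' \<in> (\<Union>x\<in>F. mball x (1/2))" using F(3) by blast
    then obtain v where v: "v \<in> F" "hdist X v (R u') < 1/2" by auto
    then have "nm (R u' - v) < 1/2" using FC RC u' commute[of v "R u'"] by (auto simp: hdist_eq)
    then have "nm (g u') \<le> 1/2"
      using near[of "R u'" v] RC u' v span_base by (force simp: g_def)
    moreover have "g u' = of_real (1 / nm u) *\<^sub>C g u"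
      unfolding u'_def by (rule linear_opD(3)[OF glin u])
    ultimately show ?thesis using nu gC[OF u] by (simp add: nm_scale field_simps del: of_real_divide)
  qed
  have "\<exists>w\<in>C. \<exists>v\<in>span F. z = w + R w + v" if z: "z \<in> C" for z
  proof -
    have "nm ((z - g x) - (z - g y)) \<le> 1/2 * nm (x - y)" if "x \<in> C" "y \<in> C" for x y
    proof -
      have "(z - g x) - (z - g y) = g (y - x)"
        using that by (simp add: linear_op_diff[OF glin subspace_C])
      then show ?thesis using half[of "y - x"] that nm_minus[of "x - y"] by simp
    qed
    then obtain w where w: "w \<in> C" "z - g w = w"
      using contraction_fixpoint[of "\<lambda>x. z - g x" "1/2"] z gC by auto
    have "z = w + g w" using w(2) by (metis diff_add_cancel)
    then have "z = w + R w + (- p (R w))" by (simp add: g_def)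
    moreover have "- p (R w) \<in> span F" using p(2) RC w(1) span_neg by blast
    ultimately show ?thesis using w by blast
  qed
  then show ?thesis using that F(1) FC by blast
qed

lemma bounded_continuous_linear_op:
  assumes "continuous_linear_op X Y f" "hilbert_space Y"
  obtains M where "\<And>x. x \<in> C \<Longrightarrow> hnorm Y (f x) \<le> M * nm x"
proof -
  interpret Y: hilbert_on scale Y using assms(2) by unfold_locales
  have lin: "linear_op X Y f" and cont: "continuous_map mtopology Y.mtopology f"
    using assms by (auto simp: continuous_linear_op_def)
  have fC: "f x \<in> Y.C" if "x \<in> C" for x using linear_opD(1)[OF lin that] .
  have "\<forall>a\<in>C. \<forall>\<epsilon>>0. \<exists>\<delta>>0. \<forall>x. x \<in> C \<and> hdist X a x < \<delta> \<longrightarrow> hdist Y (f a) (f x) < \<epsilon>"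
    using cont unfolding metric_continuous_map[OF Y.Metric_space_axioms] by (rule conjunct2)
  from this[rule_format, OF C_closed(1) zero_less_one]
  obtain r where r: "r > 0" "\<And>x. x \<in> C \<Longrightarrow> hdist X 0 x < r \<Longrightarrow> hdist Y (f 0) (f x) < 1"
    by blast
  have r': "hnorm Y (f x) < 1" if "x \<in> C" "nm x < r" for x
    using r(2)[OF that(1)] that fC[of x] linear_op_0[OF lin]
    by (simp add: hdist_eq Y.hdist_eq nm_minus Y.nm_minus)
  \<comment> \<open>Each nonzero \<open>x\<close> is rescaled to norm \<open>r / 2\<close>, strictly
    inside the ball on which \<open>f\<close> is bounded by 1.\<close>
  have "hnorm Y (f x) \<le> (2 / r) * nm x" if x: "x \<in> C" for x
  proof (cases "x = 0")
    case True
    then show ?thesis using linear_op_0[OF lin] by simp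
  next
    case False
    then have nx: "nm x > 0" using x nm_nonneg[of x] nm_eq_0[of x] by linarith
    let ?t = "r / (2 * nm x)"
    have "nm (of_real ?t *\<^sub>C x) < r" using x nx r(1) by (simp add: nm_scale del: of_real_divide of_real_mult)
    then have "hnorm Y (of_real ?t *\<^sub>C f x) < 1"
      using r'[of "of_real ?t *\<^sub>C x"] x linear_opD(3)[OF lin x, of "of_real ?t"] by simp
    then have "?t * hnorm Y (f x) < 1"
      using fC[OF x] nx r(1) by (simp add: Y.nm_scale del: of_real_divide of_real_mult)
    then show ?thesis using nx r(1) by (simp add: field_simps)
  qed
  then show ?thesis using that by blast
qed

end

section \<open>Fredholm operators from sums of operators times their adjoints\<close>

context complex_vector_space
begin

text \<open>Adding up \<open>A\<close>, \<open>Q\<close> and the span of \<open>B\<close> gives a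
  map onto \<open>Y\<close>; dually, \<open>A' y\<close>, \<open>Q' y\<close> and the numbers
  \<open>ip y b\<close> together control the norm of \<open>y\<close>. Uniform boundedness yields
  this without closedness of the separate ranges. The bijective \<open>D'\<close> and
  \<open>D\<close> differ by \<open>F\<close> with values in \<open>span B\<close>, which bounds
  both kernel and cokernel of \<open>D\<close>.\<close>

lemma fredholm_adjoint_sum:
  assumes X: "hilbert_space X" and Y: "hilbert_space Y"
    and A: "linear_op X Y A" "is_adjoint X Y A A'"
    and Q: "linear_op Y Y Q" "is_adjoint Y Y Q Q'"
    and D: "continuous_linear_op Y Y D" "\<And>y. y \<in> hcarrier Y \<Longrightarrow> D y = A (A' y) + Q (Q' y)"
    and B: "finite B" "B \<subseteq> hcarrier Y"
    and codim: "\<And>z. z \<in> hcarrier Y \<Longrightarrow> \<exists>x\<in>hcarrier X. \<exists>w\<in>hcarrier Y. \<exists>b\<in>span B. z = A x + Q w + b"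
  shows "fredholm_op Y Y D"
proof -
  interpret X: hilbert_on scale X using X by unfold_locales
  interpret Y: hilbert_on scale Y using Y by unfold_locales
  have Dlin: "linear_op Y Y D" using D(1) by (simp add: continuous_linear_op_def)
  have A'lin: "linear_op Y X A'" and Q'lin: "linear_op Y Y Q'"
    and A'adj: "\<And>x y. x \<in> X.C \<Longrightarrow> y \<in> Y.C \<Longrightarrow> Y.ip (A x) y = X.ip x (A' y)"
    and Q'adj: "\<And>x y. x \<in> Y.C \<Longrightarrow> y \<in> Y.C \<Longrightarrow> Y.ip (Q x) y = Y.ip x (Q' y)"
    using A(2) Q(2) by (auto simp: is_adjoint_def continuous_linear_op_def)
  note mem [simp] = linear_opD(1)[OF A(1)] linear_opD(1)[OF Q(1)] linear_opD(1)[OF A'lin]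
    linear_opD(1)[OF Q'lin] linear_opD(1)[OF Dlin]
  have BC [simp]: "b \<in> Y.C" if "b \<in> B" for b using that B by blast
  have spB: "span B \<subseteq> Y.C" using B Y.subspace_C span_minimal by blast
  \<comment> \<open>\<open>F\<close> is again an operator times its adjoint, for the map sending
    coefficients to combinations of \<open>B\<close>. Hence it adds the sum of
    \<open>(cmod (Y.ip y b))\<^sup>2\<close> to the quadratic form, even though \<open>B\<close>
    need not be orthonormal.\<close>
  define F where "F y = (\<Sum>b\<in>B. Y.ip y b *\<^sub>C b)" for y
  have FB: "F y \<in> span B" for y
    unfolding F_def by (intro span_sum span_scale span_base)
  have FC [simp]: "F y \<in> Y.C" for y using FB spB by blast
  \<comment> \<open>The finite-rank term makes \<open>D\<close> coercive, hence bijective.\<close>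
  define D' where "D' y = D y + F y" for y
  define E where "E = {y \<in> Y.C. X.nm (A' y) \<le> 1 \<and> Y.nm (Q' y) \<le> 1 \<and> (\<forall>b\<in>B. cmod (Y.ip y b) \<le> 1)}"
  have "\<exists>M. \<forall>y\<in>E. Y.nm y \<le> M"
  proof (rule Y.weakly_bounded_imp_bounded)
    show "E \<subseteq> Y.C" by (auto simp: E_def)
    fix z assume "z \<in> Y.C"
    then obtain x w b where z: "z = A x + Q w + b" and xwb: "x \<in> X.C" "w \<in> Y.C" "b \<in> span B"
      using codim by blast
    from xwb(3) obtain u where u: "b = (\<Sum>v\<in>B. u v *\<^sub>C v)"
      using span_finite[OF B(1)] by auto
    have bC: "b \<in> Y.C" using xwb spB by blast
    have "cmod (Y.ip y z) \<le> X.nm x + Y.nm w + (\<Sum>v\<in>B. cmod (u v))" if y: "y \<in> E" for y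
    proof -
      have yC: "y \<in> Y.C" and y1: "X.nm (A' y) \<le> 1" "Y.nm (Q' y) \<le> 1" "\<And>b. b \<in> B \<Longrightarrow> cmod (Y.ip y b) \<le> 1"
        using y by (auto simp: E_def)
      have "cmod (Y.ip y z) = cmod (Y.ip z y)"
        using Y.ip_cnj[of y z] yC \<open>z \<in> Y.C\<close> by simp
      also have "Y.ip z y = X.ip x (A' y) + Y.ip w (Q' y) + (\<Sum>v\<in>B. u v * Y.ip v y)"
        using xwb yC bC by (simp add: z Y.ip_add_left A'adj Q'adj)
          (simp add: u Y.ip_sum_left Y.ip_scale_left)
      also have "cmod \<dots> \<le> cmod (X.ip x (A' y)) + cmod (Y.ip w (Q' y)) + cmod (\<Sum>v\<in>B. u v * Y.ip v y)"
        by (meson add_mono norm_triangle_ineq order_refl order_trans)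
      also have "cmod (X.ip x (A' y)) \<le> X.nm x * 1"
        using X.Cauchy_Schwarz[of x "A' y"] mult_left_mono[OF y1(1), of "X.nm x"] xwb yC by simp
      also have "cmod (Y.ip w (Q' y)) \<le> Y.nm w * 1"
        using Y.Cauchy_Schwarz[of w "Q' y"] mult_left_mono[OF y1(2), of "Y.nm w"] xwb yC by simp
      also have "cmod (\<Sum>v\<in>B. u v * Y.ip v y) \<le> (\<Sum>v\<in>B. cmod (u v))"
      proof (rule order_trans[OF norm_sum sum_mono])
        fix v assume v: "v \<in> B"
        have "cmod (Y.ip v y) \<le> 1" using y1(3)[OF v] Y.ip_cnj[of v y] v yC by simp
        then show "cmod (u v * Y.ip v y) \<le> cmod (u v)"
          by (simp add: norm_mult mult_left_le)
      qed
      finally show ?thesis by simp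
    qed
    then show "\<exists>M. \<forall>y\<in>E. cmod (Y.ip y z) \<le> M" by blast
  qed
  then obtain M0 where M0: "\<And>y. y \<in> E \<Longrightarrow> Y.nm y \<le> M0" by blast
  define M where "M = max M0 1"
  have M: "M > 0" "\<And>y. y \<in> E \<Longrightarrow> Y.nm y \<le> M" using M0 by (force simp: M_def)+
  define q where "q y = (X.nm (A' y))\<^sup>2 + (Y.nm (Q' y))\<^sup>2 + (\<Sum>b\<in>B. (cmod (Y.ip y b))\<^sup>2)" for y
  have q0: "q y \<ge> 0" for y unfolding q_def by (intro add_nonneg_nonneg sum_nonneg) auto
  \<comment> \<open>Scaling by \<open>1 / t\<close> moves \<open>y\<close> into \<open>E\<close>.
    The free parameter \<open>t > 0\<close> stands in for \<open>sqrt (q y)\<close>, which at this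
    point may still be zero.\<close>
  have le_q: "Y.nm y \<le> M * t" if y: "y \<in> Y.C" and t: "t > 0" "q y \<le> t\<^sup>2" for y t
  proof -
    have "(X.nm (A' y))\<^sup>2 \<le> q y" "(Y.nm (Q' y))\<^sup>2 \<le> q y"
      unfolding q_def using sum_nonneg[of B "\<lambda>b. (cmod (Y.ip y b))\<^sup>2"] by auto
    then have 1: "X.nm (A' y) \<le> t" "Y.nm (Q' y) \<le> t"
      using t by (auto intro: power2_le_imp_le[OF order_trans])
    have 2: "cmod (Y.ip y b) \<le> t" if b: "b \<in> B" for b
    proof -
      have "(cmod (Y.ip y b))\<^sup>2 \<le> (\<Sum>b\<in>B. (cmod (Y.ip y b))\<^sup>2)"
        by (rule member_le_sum[OF b]) (use B in auto)
      also have "\<dots> \<le> q y" by (simp add: q_def)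
      finally have "(cmod (Y.ip y b))\<^sup>2 \<le> t\<^sup>2" using t by linarith
      then show ?thesis by (rule power2_le_imp_le) (use t in simp)
    qed
    have "of_real (1/t) *\<^sub>C y \<in> E"
      unfolding E_def using y t 1 2
      by (simp add: linear_opD(3)[OF A'lin] linear_opD(3)[OF Q'lin] X.nm_scale Y.nm_scale
          Y.ip_scale_left norm_mult norm_divide)
    then have "Y.nm (of_real (1/t) *\<^sub>C y) \<le> M" by (rule M(2))
    then show ?thesis using y t by (simp add: Y.nm_scale norm_divide field_simps)
  qed
  have coercive: "1 / M\<^sup>2 * (Y.nm y)\<^sup>2 \<le> q y" if y: "y \<in> Y.C" for y
  proof -
    \<comment> \<open>Taking \<open>t = sqrt (q y) + e / M\<close> keeps \<open>t\<close> positive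
      and costs exactly \<open>e\<close>.\<close>
    have "Y.nm y \<le> M * sqrt (q y)"
    proof (rule field_le_epsilon)
      fix e :: real assume e: "e > 0"
      have "Y.nm y \<le> M * (sqrt (q y) + e / M)"
      proof (rule le_q[OF y])
        show "0 < sqrt (q y) + e / M" using q0[of y] e M by (simp add: add_nonneg_pos)
        have "sqrt (q y) \<le> sqrt (q y) + e / M" using e M by simp
        then have "(sqrt (q y))\<^sup>2 \<le> (sqrt (q y) + e / M)\<^sup>2"
          by (rule power_mono) (simp add: q0)
        then show "q y \<le> (sqrt (q y) + e / M)\<^sup>2" by (simp add: q0)
      qed
      then show "Y.nm y \<le> M * sqrt (q y) + e" using M by (simp add: algebra_simps)
    qed
    then have "(Y.nm y)\<^sup>2 \<le> (M * sqrt (q y))\<^sup>2" using y by (intro power_mono) auto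
    then show ?thesis using M q0[of y] by (simp add: power_mult_distrib field_simps)
  qed
  have Flin: "F (x + y) = F x + F y" "F (c *\<^sub>C x) = c *\<^sub>C F x" if "x \<in> Y.C" "y \<in> Y.C" for x y c
    using that by (simp_all add: F_def Y.ip_add_left Y.ip_scale_left scale_left_distrib
        sum.distrib scale_sum_right)
  have D'lin: "linear_op Y Y D'"
    unfolding linear_op_def D'_def
    by (auto simp: linear_opD(2,3)[OF Dlin] Flin scale_right_distrib)
  have energy: "Re (Y.ip (D' y) y) = q y" if y: "y \<in> Y.C" for y
  proof -
    have "Y.ip (A (A' y)) y = of_real ((X.nm (A' y))\<^sup>2)"
      using y by (simp add: A'adj X.ip_self)
    moreover have "Y.ip (Q (Q' y)) y = of_real ((Y.nm (Q' y))\<^sup>2)"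
      using y by (simp add: Q'adj Y.ip_self)
    moreover have "Y.ip (F y) y = of_real (\<Sum>b\<in>B. (cmod (Y.ip y b))\<^sup>2)"
    proof -
      have "Y.ip (F y) y = (\<Sum>b\<in>B. Y.ip y b * Y.ip b y)"
        using y by (simp add: F_def Y.ip_sum_left Y.ip_scale_left)
      also have "\<dots> = (\<Sum>b\<in>B. of_real ((cmod (Y.ip y b))\<^sup>2))"
      proof (rule sum.cong[OF refl])
        fix b assume "b \<in> B"
        then have "Y.ip b y = cnj (Y.ip y b)" using Y.ip_cnj[of b y] y by simp
        then show "Y.ip y b * Y.ip b y = of_real ((cmod (Y.ip y b))\<^sup>2)"
          by (simp only: complex_norm_square)
      qed
      finally show ?thesis by simp
    qed
    ultimately show ?thesis
      using y by (simp add: D'_def D(2) Y.ip_add_left q_def del: of_real_power)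
  qed
  obtain K where K: "\<And>y. y \<in> Y.C \<Longrightarrow> Y.nm (D y) \<le> K * Y.nm y"
    using Y.bounded_continuous_linear_op[OF D(1) Y] by blast
  have bound: "Y.nm (D' y) \<le> (K + (\<Sum>b\<in>B. (Y.nm b)\<^sup>2)) * Y.nm y" if y: "y \<in> Y.C" for y
  proof -
    have "Y.nm (F y) \<le> (\<Sum>b\<in>B. Y.nm (Y.ip y b *\<^sub>C b))"
      unfolding F_def by (rule Y.nm_sum) simp
    also have "\<dots> \<le> (\<Sum>b\<in>B. (Y.nm b)\<^sup>2 * Y.nm y)"
    proof (rule sum_mono)
      fix b assume b: "b \<in> B"
      then show "Y.nm (Y.ip y b *\<^sub>C b) \<le> (Y.nm b)\<^sup>2 * Y.nm y"
        using mult_right_mono[OF Y.Cauchy_Schwarz[of y b], of "Y.nm b"] y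
        by (simp add: Y.nm_scale power2_eq_square mult_ac)
    qed
    finally have "Y.nm (F y) \<le> (\<Sum>b\<in>B. (Y.nm b)\<^sup>2) * Y.nm y" by (simp add: sum_distrib_right)
    then show ?thesis
      using Y.nm_triangle[of "D y" "F y"] K[OF y] y by (simp add: D'_def algebra_simps)
  qed
  have surj: "\<exists>y\<in>Y.C. D' y = z" if z: "z \<in> Y.C" for z
    using Y.coercive_surjective[OF D'lin bound _ _ z, of "1 / M\<^sup>2"] M coercive energy by auto
  have inj: "y = 0" if y: "y \<in> Y.C" "D' y = 0" for y
  proof -
    have "q y = 0" using energy[OF y(1)] y by simp
    then have "(Y.nm y)\<^sup>2 \<le> 0" using coercive[OF y(1)] M by (simp add: divide_le_0_iff)
    then show ?thesis using y by simp
  qed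
  let ?N = "{y \<in> Y.C. D y = 0}"
  have N: "subspace ?N"
    using linear_opD[OF Dlin] linear_op_0[OF Dlin] by (auto intro!: subspaceI)
  \<comment> \<open>On the kernel of \<open>D\<close> the injective operator \<open>D'\<close>
    agrees with \<open>F\<close>, so it embeds this kernel into \<open>span B\<close>.\<close>
  obtain N' where N': "finite N'" "span N' = ?N"
  proof (rule finite_spanning_linear_preimage[OF D'lin N])
    show "D' ` ?N \<subseteq> span B" using FB by (auto simp: D'_def)
    show "x \<in> span {}" if "x \<in> ?N" "D' x = 0" for x using inj that by auto
  qed (use B in auto)
  have "Y.C = span (D ` Y.C \<union> B)"
  proof
    show "span (D ` Y.C \<union> B) \<subseteq> Y.C"
      using B Y.subspace_C by (intro span_minimal) auto
    show "Y.C \<subseteq> span (D ` Y.C \<union> B)"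
    proof
      fix z assume "z \<in> Y.C"
      then obtain y where y: "y \<in> Y.C" "z = D y + F y" using surj by (auto simp: D'_def)
      have "F y \<in> span (D ` Y.C \<union> B)" using FB span_mono[of B "D ` Y.C \<union> B"] by auto
      moreover have "D y \<in> span (D ` Y.C \<union> B)" using y by (intro span_base) blast
      ultimately show "z \<in> span (D ` Y.C \<union> B)" unfolding y(2) by (rule span_add[rotated])
    qed
  qed
  then show ?thesis
    unfolding fredholm_op_def using D(1) N' B by (metis (lifting))
qed

end

text \<open>By convention the distance of the smaller space vanishes off \<open>S\<close>, so as a
  function it is not \<open>hdist X\<close>; the two topologies are therefore compared through their
  balls.\<close>

lemma (in hilbert_on) htop_subspace:
  assumes S: "S \<subseteq> C"
  shows "htop \<lparr>hcarrier = S, hinner = ip\<rparr> = subtopology mtopology S"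
proof -
  let ?d = "hdist \<lparr>hcarrier = S, hinner = ip\<rparr>"
  have d: "?d x y = (if x \<in> S \<and> y \<in> S then hdist X x y else 0)" for x y
    using S by (auto simp: hdist_def hnorm_def)
  interpret sub: Submetric C "hdist X" S using S by unfold_locales
  interpret S: Metric_space S ?d
    by unfold_locales (auto simp: d commute sub.sub.triangle)
  have "S.mball x r = sub.sub.mball x r" for x r
    by (auto simp: d)
  then have "S.mopen = sub.sub.mopen"
    by (simp add: fun_eq_iff S.mopen_def sub.sub.mopen_def)
  then show ?thesis
    by (simp add: S.mtopology_def sub.sub.mtopology_def flip: sub.mtopology_submetric)
qed


section \<open>Parametrices in Toeplitz subalgebras\<close>

context operator_algebra
begin

lemma subspace_H: "subspace (hcarrier (H s g))"
  using hilbert[of s g] by (simp add: hilbert_space_def)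

lemma H0_closed [simp]:
  "0 \<in> H0 g" "x \<in> H0 g \<Longrightarrow> y \<in> H0 g \<Longrightarrow> x + y \<in> H0 g" "x \<in> H0 g \<Longrightarrow> y \<in> H0 g \<Longrightarrow> x - y \<in> H0 g"
  "x \<in> H0 g \<Longrightarrow> c *\<^sub>C x \<in> H0 g"
  using subspace_H[of 0 g] by (auto simp: subspace_0 subspace_add subspace_diff subspace_scale)

lemma L_cong:
  assumes "(g0, g1) \<in> G" "\<mu> \<le> 0" "A \<in> L \<mu> g0 g1" "\<And>x. x \<in> H0 g0 \<Longrightarrow> A x = B x" "B \<in> extensional (H0 g0)"
  shows "B \<in> L \<mu> g0 g1"
proof -
  have "A = B"
    using extensionalityI[OF L_extensional[OF assms(1-3)] assms(5)] assms(4) by blast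
  then show ?thesis using assms(3) by simp
qed

lemma L_diff:
  assumes "(g0, g1) \<in> G" "\<mu> \<le> 0" "A \<in> L \<mu> g0 g1" "B \<in> L \<mu> g0 g1"
  shows "op_diff g0 A B \<in> L \<mu> g0 g1"
  by (rule L_cong[OF assms(1,2) L_add[OF assms(1-3) L_scale[OF assms(1,2,4), of "-1"]]]) auto

lemma L_mem [simp]:
  assumes "(g0, g1) \<in> G" "A \<in> L 0 g0 g1" "x \<in> H0 g0"
  shows "A x \<in> H0 g1"
  using linear_opD(1)[OF L_linear[OF assms(1) order_refl assms(2)] assms(3)] .

lemma L_apply_add:
  "(g0, g1) \<in> G \<Longrightarrow> A \<in> L 0 g0 g1 \<Longrightarrow> x \<in> H0 g0 \<Longrightarrow> y \<in> H0 g0 \<Longrightarrow> A (x + y) = A x + A y"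
  using linear_opD(2)[OF L_linear[of g0 g1 0 A]] by simp

lemma L_apply_diff:
  "(g0, g1) \<in> G \<Longrightarrow> A \<in> L 0 g0 g1 \<Longrightarrow> x \<in> H0 g0 \<Longrightarrow> y \<in> H0 g0 \<Longrightarrow> A (x - y) = A x - A y"
  using linear_op_diff[OF L_linear[of g0 g1 0 A] subspace_H] by simp

lemma L_compose_0:
  "(g0, g1) \<in> G \<Longrightarrow> (g1, g2) \<in> G \<Longrightarrow> A \<in> L 0 g1 g2 \<Longrightarrow> B \<in> L 0 g0 g1 \<Longrightarrow> op_prod g0 A B \<in> L 0 g0 g2"
  using L_compose[of g0 g1 g2 0 0 A B] by simp

lemma L_smoothing_iff: "R \<in> L_smoothing g0 g1 \<longleftrightarrow> (\<forall>\<mu>\<le>0. R \<in> L \<mu> g0 g1)"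
  by (auto simp: L_smoothing_def)

lemma L_smoothing_imp_L: "R \<in> L_smoothing g0 g1 \<Longrightarrow> R \<in> L 0 g0 g1"
  by (simp add: L_smoothing_iff)

lemma L_smoothing_compose_left:
  assumes "(g0, g1) \<in> G" "(g1, g2) \<in> G" "A \<in> L 0 g1 g2" "R \<in> L_smoothing g0 g1"
  shows "op_prod g0 A R \<in> L_smoothing g0 g2"
  using L_compose[OF assms(1,2) order_refl _ assms(3)] assms(4) by (force simp: L_smoothing_iff)

lemma L_smoothing_compose_right:
  assumes "(g0, g1) \<in> G" "(g1, g2) \<in> G" "R \<in> L_smoothing g1 g2" "A \<in> L 0 g0 g1"
  shows "op_prod g0 R A \<in> L_smoothing g0 g2"
  using L_compose[OF assms(1,2) _ order_refl _ assms(4)] assms(3) by (force simp: L_smoothing_iff)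

lemma L_smoothing_diff:
  "(g0, g1) \<in> G \<Longrightarrow> R \<in> L_smoothing g0 g1 \<Longrightarrow> S \<in> L_smoothing g0 g1 \<Longrightarrow> op_diff g0 R S \<in> L_smoothing g0 g1"
  by (simp add: L_smoothing_iff L_diff)

lemma L_smoothing_add:
  "(g0, g1) \<in> G \<Longrightarrow> R \<in> L_smoothing g0 g1 \<Longrightarrow> S \<in> L_smoothing g0 g1 \<Longrightarrow>
    (\<lambda>x\<in>H0 g0. R x + S x) \<in> L_smoothing g0 g1"
  by (simp add: L_smoothing_iff L_add)

lemma is_projection_apply: "is_projection g P \<Longrightarrow> x \<in> H0 g \<Longrightarrow> P (P x) = P x"
  by (metis compose_eq is_projection_def)

text \<open>Extensionality turns the two annihilation equations into identities of values. In this
  form projections next to \<open>A\<close> are absorbed by rewriting, and all later computations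
  are pointwise.\<close>

lemma T_iff:
  assumes G: "(g0, g1) \<in> G" and P: "is_projection g0 P0" "is_projection g1 P1" and "\<mu> \<le> 0"
  shows "A \<in> T \<mu> g0 g1 P0 P1 \<longleftrightarrow> A \<in> L \<mu> g0 g1 \<and> (\<forall>x\<in>H0 g0. P1 (A x) = A x \<and> A (P0 x) = A x)"
proof (cases "A \<in> L \<mu> g0 g1")
  case True
  have A0: "A \<in> L 0 g0 g1" using L_mono[OF G \<open>\<mu> \<le> 0\<close> order_refl] True by blast
  have P': "P0 \<in> L 0 g0 g0" using P by (simp add: is_projection_def)
  note g = admissible_left[OF G]
  have eq: "a - b = 0 \<longleftrightarrow> b = a" for a b :: 'v by auto
  have "op_prod g0 (op_diff g1 (op_one g1) P1) A = (\<lambda>x\<in>H0 g0. 0) \<longleftrightarrow> (\<forall>x\<in>H0 g0. A x - P1 (A x) = 0)"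
    using L_mem[OF G A0] by (auto simp: fun_eq_iff compose_def restrict_def)
  then have 1: "op_prod g0 (op_diff g1 (op_one g1) P1) A = (\<lambda>x\<in>H0 g0. 0) \<longleftrightarrow> (\<forall>x\<in>H0 g0. P1 (A x) = A x)"
    by (simp only: eq)
  have "op_prod g0 A (op_diff g0 (op_one g0) P0) = (\<lambda>x\<in>H0 g0. 0) \<longleftrightarrow> (\<forall>x\<in>H0 g0. A x - A (P0 x) = 0)"
    using L_mem[OF g P'] L_apply_diff[OF G A0] by (auto simp: fun_eq_iff compose_def restrict_def)
  then have 2: "op_prod g0 A (op_diff g0 (op_one g0) P0) = (\<lambda>x\<in>H0 g0. 0) \<longleftrightarrow> (\<forall>x\<in>H0 g0. A (P0 x) = A x)"
    by (simp only: eq)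
  show ?thesis
    using True unfolding T_def mem_Collect_eq 1 2 by blast
qed (simp add: T_def)

lemma T_smoothing_iff:
  assumes "(g0, g1) \<in> G" "is_projection g0 P0" "is_projection g1 P1"
  shows "R \<in> T_smoothing g0 g1 P0 P1 \<longleftrightarrow>
    R \<in> L_smoothing g0 g1 \<and> (\<forall>x\<in>H0 g0. P1 (R x) = R x \<and> R (P0 x) = R x)"
  by (auto simp: T_smoothing_def L_smoothing_def T_iff[OF assms])

lemma projection_range:
  assumes "(g, g) \<in> G" "is_projection g P"
  shows "P ` H0 g = {x \<in> H0 g. P x = x}"
proof -
  have "P x \<in> H0 g" if "x \<in> H0 g" for x
    using assms that by (auto simp: is_projection_def)
  then show ?thesis using is_projection_apply[OF assms(2)] by (force intro: image_eqI)
qed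

text \<open>Only the range of \<open>A\<close> is constrained, not its kernel. This is what allows a
  second application, to the parametrix produced by the first.\<close>

lemma right_parametrix:
  assumes fred: L_fredholm_property and star: L_star_closed
    and G: "(g0, g1) \<in> G" and P: "is_projection g0 P0" "is_projection g1 P1"
    and A: "A \<in> T 0 g0 g1 P0 P1"
    and F: "finite F" "F \<subseteq> H0 g1"
    and codim: "\<And>z. z \<in> P1 ` H0 g1 \<Longrightarrow> \<exists>x\<in>H0 g0. \<exists>b\<in>span F. z = A x + b"
  obtains B where "B \<in> T 0 g1 g0 P1 P0" "op_diff g1 (op_prod g1 A B) P1 \<in> T_smoothing g1 g1 P1 P1"
proof -
  note g = admissible_left[OF G] admissible_right[OF G] admissible_inverse[OF G] G
  have P0: "P0 \<in> L 0 g0 g0" and P1: "P1 \<in> L 0 g1 g1" using P by (auto simp: is_projection_def)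
  have AL: "A \<in> L 0 g0 g1" and P1A: "\<And>x. x \<in> H0 g0 \<Longrightarrow> P1 (A x) = A x"
    and AP0: "\<And>x. x \<in> H0 g0 \<Longrightarrow> A (P0 x) = A x"
    using A by (auto simp: T_iff[OF G P])
  define Q where "Q = op_diff g1 (op_one g1) P1"
  have Q: "Q \<in> L 0 g1 g1" unfolding Q_def using L_diff[OF g(2) _ L_one[OF g(2)] P1] by simp
  have Qx: "Q x = x - P1 x" if "x \<in> H0 g1" for x using that by (simp add: Q_def)
  obtain A' where A': "A' \<in> L 0 g1 g0" "is_adjoint (H 0 g0) (H 0 g1) A A'"
    using star G AL by (fastforce simp: L_star_closed_def)
  obtain Q' where Q': "Q' \<in> L 0 g1 g1" "is_adjoint (H 0 g1) (H 0 g1) Q Q'"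
    using star g(2) Q by (fastforce simp: L_star_closed_def)
  define D where "D = (\<lambda>y\<in>H0 g1. op_prod g1 A A' y + op_prod g1 Q Q' y)"
  have Dy: "D y = A (A' y) + Q (Q' y)" if "y \<in> H0 g1" for y
    using that by (simp add: D_def compose_eq)
  have D: "D \<in> L 0 g1 g1"
    unfolding D_def
    by (rule L_add[OF g(2) order_refl L_compose_0[OF g(3,4) AL A'(1)] L_compose_0[OF g(2,2) Q Q'(1)]])
  have "fredholm_op (H 0 g1) (H 0 g1) D"
  proof (rule fredholm_adjoint_sum[OF hilbert hilbert L_linear[OF G order_refl AL] A'(2)
        L_linear[OF g(2) order_refl Q] Q'(2) _ Dy F])
    show "continuous_linear_op (H 0 g1) (H 0 g1) D"
      using L_continuous[OF g(2) order_refl D, of 0] by simp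
    fix z assume z: "z \<in> H0 g1"
    \<comment> \<open>The hypothesis reaches only the part \<open>P1 z\<close>; the remaining part
      of \<open>z\<close> is \<open>Q z\<close>.\<close>
    then obtain x b where "x \<in> H0 g0" "b \<in> span F" "P1 z = A x + b" using codim by blast
    moreover from this have "z = A x + Q z + b" using Qx[OF z] by (simp add: algebra_simps)
    ultimately show "\<exists>x\<in>H0 g0. \<exists>w\<in>H0 g1. \<exists>b\<in>span F. z = A x + Q w + b"
      using z by blast
  qed
  then have "L_elliptic g1 g1 D" using fred g(2) D by (auto simp: L_fredholm_property_def)
  then obtain E where E: "E \<in> L 0 g1 g1"
    and R: "op_diff g1 (op_prod g1 D E) (op_one g1) \<in> L_smoothing g1 g1"
    by (auto simp: L_elliptic_def)
  \<comment> \<open>The outer projections place \<open>B\<close> in the Toeplitz class. The left one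
    disappears in \<open>A B\<close> since \<open>A P0 = A\<close>, which leaves
    \<open>A A' E P1 = P1 D E P1\<close>.\<close>
  define B where "B = op_prod g1 P0 (op_prod g1 A' (op_prod g1 E P1))"
  let ?R = "op_diff g1 (op_prod g1 D E) (op_one g1)"
  have Bx: "B x = P0 (A' (E (P1 x)))" if "x \<in> H0 g1" for x using that by (simp add: B_def compose_eq)
  have mem [simp]: "P1 x \<in> H0 g1" "E x \<in> H0 g1" "A' x \<in> H0 g0" "Q x \<in> H0 g1" "Q' x \<in> H0 g1" "D x \<in> H0 g1"
    if "x \<in> H0 g1" for x
    using that g P1 E A' Q Q' D by auto
  have mem0 [simp]: "P0 x \<in> H0 g0" "A x \<in> H0 g1" if "x \<in> H0 g0" for x
    using that g P0 AL by auto
  have "B \<in> L 0 g1 g0"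
    unfolding B_def
    by (intro L_compose_0[OF g(3,1) P0] L_compose_0[OF g(2,3) A'(1)] L_compose_0[OF g(2,2) E P1])
  then have B: "B \<in> T 0 g1 g0 P1 P0"
    by (simp add: T_iff[OF g(3) P(2,1)] Bx is_projection_apply[OF P(1)] is_projection_apply[OF P(2)])
  have P1D: "P1 (D y) = A (A' y)" if y: "y \<in> H0 g1" for y
    using y by (simp add: Dy L_apply_add[OF g(2) P1] P1A Qx L_apply_diff[OF g(2) P1]
        is_projection_apply[OF P(2)])
  have ABx: "A (B x) - P1 x = P1 (?R (P1 x))" if x: "x \<in> H0 g1" for x
    using x by (simp add: Bx AP0 P1D[symmetric] compose_eq L_apply_diff[OF g(2) P1] is_projection_apply[OF P(2)])
  have S: "op_diff g1 (op_prod g1 A B) P1 = op_prod g1 P1 (op_prod g1 ?R P1)"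
    using ABx by (auto simp: fun_eq_iff compose_def restrict_def)
  have "op_diff g1 (op_prod g1 A B) P1 \<in> T_smoothing g1 g1 P1 P1"
    unfolding T_smoothing_iff[OF g(2) P(2) P(2)]
  proof (intro conjI ballI)
    show "op_diff g1 (op_prod g1 A B) P1 \<in> L_smoothing g1 g1"
      unfolding S
      by (intro L_smoothing_compose_left[OF g(2) g(2) P1] L_smoothing_compose_right[OF g(2) g(2) R P1])
    have RL: "?R \<in> L 0 g1 g1" using R by (rule L_smoothing_imp_L)
    show "P1 (op_diff g1 (op_prod g1 A B) P1 x) = op_diff g1 (op_prod g1 A B) P1 x"
      "op_diff g1 (op_prod g1 A B) P1 (P1 x) = op_diff g1 (op_prod g1 A B) P1 x" if "x \<in> H0 g1" for x
      unfolding S using that L_mem[OF g(2) RL]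
      by (simp_all add: compose_eq is_projection_apply[OF P(2)] del: restrict_apply restrict_apply')
  qed
  then show ?thesis using that B by blast
qed

text \<open>The range is the set where two continuous maps, \<open>P\<close> and the identity, agree
  in a Hausdorff space.\<close>

lemma closedin_projection_range:
  assumes "(g, g) \<in> G" "is_projection g P"
  shows "closedin (htop (H 0 g)) (P ` H0 g)"
proof -
  interpret hilbert_on scale "H 0 g" using hilbert by unfold_locales
  have "continuous_map mtopology mtopology P"
    using assms L_continuous[of g g 0 P 0] by (simp add: is_projection_def continuous_linear_op_def)
  from closedin_continuous_maps_eq[OF Hausdorff_space_mtopology this continuous_map_id]
  show ?thesis by (simp add: projection_range[OF assms])
qed

text \<open>The unit ball of the range of \<open>P0\<close> lies in that of \<open>H0 g0\<close>,
  the norm being the same. As the range of \<open>P1\<close> is closed, the closure of the image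
  taken inside it is a closed subset of the compact closure of the larger image.\<close>

lemma T_smoothing_compact:
  assumes G: "(g0, g1) \<in> G" and P: "is_projection g0 P0" "is_projection g1 P1"
    and R: "R \<in> T_smoothing g0 g1 P0 P1" and compact: "compact_op (H 0 g0) (H 0 g1) R"
  shows "compact_op (HP 0 g0 P0) (HP 0 g1 P1) R"
proof -
  interpret hilbert_on scale "H 0 g1" using hilbert by unfold_locales
  let ?S = "P1 ` H0 g1" and ?U = "R ` {x \<in> P0 ` H0 g0. hnorm (H 0 g0) x \<le> 1}"
  note g = admissible_left[OF G] admissible_right[OF G]
  have P0: "P0 ` H0 g0 \<subseteq> H0 g0" and S: "?S \<subseteq> H0 g1"
    using projection_range[OF g(1) P(1)] projection_range[OF g(2) P(2)] by auto
  have lin: "linear_op (H 0 g0) (H 0 g1) R" using compact by (simp add: compact_op_def)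
  have RS: "R x \<in> ?S" if "x \<in> H0 g0" for x
    using R that linear_opD(1)[OF lin that] by (auto simp: T_smoothing_iff[OF G P] projection_range[OF g(2) P(2)])
  have "linear_op (HP 0 g0 P0) (HP 0 g1 P1) R"
    using linear_opD(2,3)[OF lin] P0 RS by (auto simp: linear_op_def HP_def subset_iff)
  moreover have "compactin (subtopology mtopology ?S) (subtopology mtopology ?S closure_of ?U)"
    unfolding compactin_subtopology closure_of_subtopology
  proof (rule conjI[OF closed_compactin])
    show "compactin mtopology (mtopology closure_of (R ` {x \<in> H0 g0. hnorm (H 0 g0) x \<le> 1}))"
      using compact by (simp add: compact_op_def)
    show "?S \<inter> mtopology closure_of (?S \<inter> ?U) \<subseteq> mtopology closure_of (R ` {x \<in> H0 g0. hnorm (H 0 g0) x \<le> 1})"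
      using P0 by (intro le_infI2 closure_of_mono) auto
  qed (auto simp: closedin_Int closedin_projection_range[OF g(2) P(2)])
  moreover have "hnorm (HP 0 g0 P0) = hnorm (H 0 g0)"
    by (simp add: fun_eq_iff hnorm_def HP_def)
  moreover have "htop (HP 0 g1 P1) = subtopology mtopology ?S"
    unfolding HP_def by (rule htop_subspace[OF S])
  ultimately show ?thesis by (simp add: compact_op_def HP_def)
qed

text \<open>The two finiteness conditions enter separately: the cokernel of \<open>A\<close> gives
  the right parametrix \<open>B\<close>, and the kernel of \<open>A\<close> gives finite codimension
  of the range of \<open>B\<close> in that of \<open>P0\<close>, hence a right parametrix
  \<open>A2\<close> of \<open>B\<close>.\<close>

lemma T_fredholm_imp_elliptic:
  assumes fred: L_fredholm_property and star: L_star_closed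
    and G: "(g0, g1) \<in> G" and P: "is_projection g0 P0" "is_projection g1 P1"
    and A: "A \<in> T 0 g0 g1 P0 P1" and AF: "fredholm_op (HP 0 g0 P0) (HP 0 g1 P1) A"
  shows "T_elliptic g0 g1 P0 P1 A"
proof -
  interpret Y: hilbert_on scale "H 0 g1" using hilbert by unfold_locales
  note g = admissible_left[OF G] admissible_right[OF G] admissible_inverse[OF G]
  note ran0 = projection_range[OF g(1) P(1)] and ran1 = projection_range[OF g(2) P(2)]
  have PL: "P0 \<in> L 0 g0 g0" "P1 \<in> L 0 g1 g1" using P by (auto simp: is_projection_def)
  note lin0 = L_linear[OF g(1) order_refl PL(1)] and lin1 = L_linear[OF g(2) order_refl PL(2)]
  have AL: "A \<in> L 0 g0 g1" and P1A: "\<And>x. x \<in> H0 g0 \<Longrightarrow> P1 (A x) = A x"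
    and AP0: "\<And>x. x \<in> H0 g0 \<Longrightarrow> A (P0 x) = A x"
    using A by (auto simp: T_iff[OF G P])
  note linA = L_linear[OF G order_refl AL]
  have sub0: "subspace (P0 ` H0 g0)" "P0 ` H0 g0 \<subseteq> H0 g0"
    using subspace_linear_op_image[OF lin0 subspace_H order_refl] linear_opD(1)[OF lin0] by auto
  obtain N where N: "finite N" "{x \<in> P0 ` H0 g0. A x = 0} = span N"
    using AF by (auto simp: fredholm_op_def HP_def)
  obtain F where F: "finite F" "F \<subseteq> P1 ` H0 g1" "P1 ` H0 g1 = span (A ` P0 ` H0 g0 \<union> F)"
    using AF by (auto simp: fredholm_op_def HP_def)
  obtain B where B: "B \<in> T 0 g1 g0 P1 P0"
    and S: "op_diff g1 (op_prod g1 A B) P1 \<in> T_smoothing g1 g1 P1 P1"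
  proof (rule right_parametrix[OF fred star G P A F(1)])
    show "F \<subseteq> H0 g1" using F(2) ran1 by auto
    fix z assume "z \<in> P1 ` H0 g1"
    then obtain u b where z: "z = u + b" "u \<in> span (A ` P0 ` H0 g0)" "b \<in> span F"
      unfolding F(3) span_Un by blast
    \<comment> \<open>The Fredholm condition speaks of the span of the image together with
      \<open>F\<close>; the image is already a subspace, so a single preimage \<open>x\<close>
      suffices.\<close>
    have "span (A ` P0 ` H0 g0) = A ` P0 ` H0 g0"
      using subspace_linear_op_image[OF linA sub0] by (simp add: span_eq_iff)
    with z(2) have "u \<in> A ` P0 ` H0 g0" by (simp only:)
    then obtain x where "x \<in> H0 g0" "u = A x" using sub0(2) by blast
    then show "\<exists>x\<in>H0 g0. \<exists>b\<in>span F. z = A x + b" using z by blast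
  qed
  define S where "S = op_diff g1 (op_prod g1 A B) P1"
  have S_smooth: "S \<in> L_smoothing g1 g1" and P1S: "\<And>x. x \<in> H0 g1 \<Longrightarrow> P1 (S x) = S x"
    using S by (auto simp: T_smoothing_iff[OF g(2) P(2,2)] S_def[symmetric])
  have BL: "B \<in> L 0 g1 g0" and P0B: "\<And>x. x \<in> H0 g1 \<Longrightarrow> P0 (B x) = B x"
    and BP1: "\<And>x. x \<in> H0 g1 \<Longrightarrow> B (P1 x) = B x"
    using B by (auto simp: T_iff[OF g(3) P(2,1)])
  have ABx: "A (B x) = P1 x + S x" if "x \<in> H0 g1" for x
    using that by (simp add: S_def compose_eq)
  have mem0 [simp]: "P0 x \<in> H0 g0" "A x \<in> H0 g1" if "x \<in> H0 g0" for x
    using that G g PL AL by auto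
  have mem1 [simp]: "P1 x \<in> H0 g1" "B x \<in> H0 g0" "S x \<in> H0 g1" if "x \<in> H0 g1" for x
    using that g PL BL L_smoothing_imp_L[OF S_smooth] by auto
  \<comment> \<open>By Riesz theory \<open>A B = P1 + S\<close> has finite codimension; as \<open>A\<close> has finite-dimensional kernel,
    so has \<open>B\<close>, and the right parametrix construction applies to \<open>B\<close>.\<close>
  obtain F1 where F1: "finite F1" "F1 \<subseteq> H0 g1"
    "\<And>z. z \<in> H0 g1 \<Longrightarrow> \<exists>w\<in>H0 g1. \<exists>v\<in>span F1. z = w + S w + v"
  proof (rule Y.compact_perturbation_finite_codim)
    show "compact_op (H 0 g1) (H 0 g1) S"
      using fred g(2) S_smooth by (auto simp: L_fredholm_property_def)
  qed blast
  define U where "U = {u \<in> P0 ` H0 g0. A u \<in> span (P1 ` F1)}"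
  have U: "subspace U" "U \<subseteq> H0 g0"
  proof -
    show "subspace U"
      using sub0 linear_opD(2,3)[OF linA] linear_op_0[OF linA]
      unfolding U_def by (intro subspaceI)
        (auto simp: subspace_0 subspace_add subspace_scale span_add span_scale span_zero subset_iff simp del: image_iff)
    show "U \<subseteq> H0 g0" using sub0(2) by (auto simp: U_def)
  qed
  obtain F2 where F2: "finite F2" "F2 \<subseteq> U" "span F2 = U"
  proof (rule finite_spanning_linear_preimage[OF linA U])
    show "x \<in> span N" if "x \<in> U" "A x = 0" for x using that N(2) by (auto simp: U_def)
    show "A ` U \<subseteq> span (P1 ` F1)" by (auto simp: U_def)
  qed (use N(1) F1(1) in auto)
  obtain A2 where A2: "A2 \<in> T 0 g0 g1 P0 P1"
    and S2': "op_diff g0 (op_prod g0 B A2) P0 \<in> T_smoothing g0 g0 P0 P0"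
  proof (rule right_parametrix[OF fred star g(3) P(2,1) B F2(1)])
    show "F2 \<subseteq> H0 g0" using F2(2) U(2) by blast
    fix x assume x: "x \<in> P0 ` H0 g0"
    then have xC: "x \<in> H0 g0" using sub0(2) by blast
    obtain w v where wv: "w \<in> H0 g1" "v \<in> span F1" "A x = w + S w + v" using F1(3) xC by force
    have vC: "v \<in> H0 g1" using wv(2) F1(2) subspace_H span_minimal by blast
    \<comment> \<open>Applying \<open>P1\<close> fixes \<open>A x\<close> and \<open>S w\<close>, so
      the first two summands become \<open>P1 w + S w = A (B w)\<close>.\<close>
    have "A x = P1 w + P1 (S w) + P1 v"
      using P1A[OF xC] wv vC by (simp add: L_apply_add[OF g(2) PL(2)])
    then have "A (x - B w) = P1 v"
      using wv xC by (simp add: L_apply_diff[OF G AL] ABx P1S)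
    moreover have "P1 v \<in> span (P1 ` F1)"
    proof -
      have "subspace (P1 ` span F1)"
        using F1(2) subspace_H span_minimal by (intro subspace_linear_op_image[OF lin1]) auto
      then have sub: "subspace {v \<in> H0 g1. P1 v \<in> span (P1 ` F1)}"
        using linear_opD(2,3)[OF lin1] linear_op_0[OF lin1]
        by (intro subspaceI) (auto simp: span_add span_scale span_zero)
      have "span F1 \<subseteq> {v \<in> H0 g1. P1 v \<in> span (P1 ` F1)}"
        using F1(2) by (intro span_minimal[OF _ sub]) (auto intro: span_base)
      then show ?thesis using wv(2) by blast
    qed
    moreover have "B w \<in> P0 ` H0 g0" using wv(1) P0B by (force simp: ran0)
    ultimately have "x - B w \<in> span F2"
      using x subspace_diff[OF sub0(1)] unfolding F2(3) U_def by simp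
    moreover have "x = B w + (x - B w)" by simp
    ultimately show "\<exists>w\<in>H0 g1. \<exists>b\<in>span F2. x = B w + b" using wv(1) by blast
  qed
  define S2 where "S2 = op_diff g0 (op_prod g0 B A2) P0"
  have S2_smooth: "S2 \<in> L_smoothing g0 g0"
    using S2' by (auto simp: T_smoothing_iff[OF g(1) P(1,1)] S2_def[symmetric])
  have A2L: "A2 \<in> L 0 g0 g1" and P1A2: "\<And>x. x \<in> H0 g0 \<Longrightarrow> P1 (A2 x) = A2 x"
    using A2 by (auto simp: T_iff[OF G P])
  have mem2 [simp]: "A2 x \<in> H0 g1" "S2 x \<in> H0 g0" if "x \<in> H0 g0" for x
    using that G g A2L L_smoothing_imp_L[OF S2_smooth] by auto
  have BA2x: "B (A2 x) = P0 x + S2 x" if "x \<in> H0 g0" for x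
    using that by (simp add: S2_def compose_eq)
  \<comment> \<open>\<open>A = A (B A2 - S2) = A2 + S A2 - A S2\<close>: the two parametrices of \<open>B\<close> agree modulo smoothing.\<close>
  have Ax: "A x = A2 x + S (A2 x) - A (S2 x)" if x: "x \<in> H0 g0" for x
  proof -
    have "A x = A (B (A2 x) - S2 x)" using x by (simp add: BA2x AP0)
    also have "\<dots> = A (B (A2 x)) - A (S2 x)" using x by (simp add: L_apply_diff[OF G AL])
    finally show ?thesis using x by (simp add: ABx P1A2)
  qed
  \<comment> \<open>On \<open>H0 g0\<close> this is \<open>A - A2\<close>, written so that smoothing
    is visible; then \<open>B A - P0 = (B A2 - P0) + B (A - A2)\<close> is
    \<open>S2 + B ?K\<close>.\<close>
  let ?K = "op_diff g0 (op_prod g0 S A2) (op_prod g0 A S2)"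
  have BAx: "B (A x) - P0 x = S2 x + B (?K x)" if x: "x \<in> H0 g0" for x
  proof -
    have "B (A x) = B (A2 x + (S (A2 x) - A (S2 x)))" by (simp only: Ax[OF x] add_diff_eq)
    then show ?thesis using x by (simp add: L_apply_add[OF g(3) BL] BA2x compose_eq)
  qed
  have "op_diff g0 (op_prod g0 B A) P0 = (\<lambda>x\<in>H0 g0. S2 x + op_prod g0 B ?K x)"
    using BAx by (auto simp: fun_eq_iff compose_def restrict_def)
  moreover have "(\<lambda>x\<in>H0 g0. S2 x + op_prod g0 B ?K x) \<in> L_smoothing g0 g0"
    by (intro L_smoothing_add[OF g(1) S2_smooth] L_smoothing_compose_left[OF G g(3) BL]
        L_smoothing_diff[OF G] L_smoothing_compose_right[OF G g(2) S_smooth A2L]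
        L_smoothing_compose_left[OF g(1) G AL S2_smooth])
  ultimately have "op_diff g0 (op_prod g0 B A) P0 \<in> L_smoothing g0 g0"
    by (simp only:)
  then have "op_diff g0 (op_prod g0 B A) P0 \<in> T_smoothing g0 g0 P0 P0"
    unfolding T_smoothing_iff[OF g(1) P(1,1)]
    by (auto simp: compose_eq L_apply_diff[OF g(1) PL(1)] P0B AP0 is_projection_apply[OF P(1)])
  then show ?thesis
    unfolding T_elliptic_def using A B S by blast
qed

end

theorem theorem3p7:
  fixes scale :: "complex \<Rightarrow> 'v::ab_group_add \<Rightarrow> 'v"
    and H :: "nat \<Rightarrow> 'd \<Rightarrow> 'v hspace"
    and G :: "('d \<times> 'd) set"
    and L :: "int \<Rightarrow> 'd \<Rightarrow> 'd \<Rightarrow> ('v \<Rightarrow> 'v) set"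
  assumes "operator_algebra scale H G L"
    and "operator_algebra.L_fredholm_property scale H G L"
    and "operator_algebra.L_star_closed scale H G L"
  shows "operator_algebra.T_fredholm_property scale H G L"
proof -
  interpret operator_algebra scale H G L by fact
  show ?thesis
    unfolding T_fredholm_property_def
  proof (clarify, intro conjI ballI impI)
    fix g0 g1 P0 P1
    assume G: "(g0, g1) \<in> G" and P: "is_projection g0 P0" "is_projection g1 P1"
    show "compact_op (HP 0 g0 P0) (HP 0 g1 P1) R" if "R \<in> T_smoothing g0 g1 P0 P1" for R
      using T_smoothing_compact[OF G P that] assms(2) that G
      by (auto simp: L_fredholm_property_def T_smoothing_iff[OF G P])
    show "T_elliptic g0 g1 P0 P1 A"
      if "A \<in> T 0 g0 g1 P0 P1" "fredholm_op (HP 0 g0 P0) (HP 0 g1 P1) A" for A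
      using T_fredholm_imp_elliptic[OF assms(2,3) G P that] .
  qed
qed

end
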